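(* Let $A\in\mathbb{R}^{n\times n}$ be such that its directed graph $G=(V,E)$ is strongly connected. Given the cardinality limit $K\in\mathbb{N}$ and an exclusion set $R\subset V$, we have $R\in\tilde{\mathcal{R}}_K$ if and only if there exists a flow $g$ in $(\mathcal{H}_r(V\setminus R),c,s,t)$ with $\mathrm{val}(g)=n$.
   Context: $V=\{v_1,\dots,v_n\}$; $(v_j,v_i)\in E$ exactly when $A_{ij}\neq0$. Here $\subset$ allows equality. For $S\subset V$, $B(S)\in\mathbb{R}^{n\times n}$ is the diagonal matrix with $i$th diagonal entry $1$ if $v_i\in S$ and $0$ otherwise. A pair $(\hat A,\hat B)$ of real $n\times n$ matrices is controllable if $[\hat B\ \hat A\hat B\cdots\hat A^{n-1}\hat B]$ has rank $n$. $(A,B(S))$ is structurally controllable if there is a controllable pair of real $n\times n$ matrices $(\hat A,\hat B)$ such that $[\hat A\ \hat B]$ and $[A\ B(S)]$ have zeros at the same entries. $\mathcal{C}_K=\{S\subset V:|S|=K,\ (A,B(S))\text{ is structurally controllable}\}$, $\mathcal{R}_K=\{R\subset V:V\setminus R\in\mathcal C_K\}$, and $\tilde{\mathcal R}_K=\{Q:\exists R\in\mathcal R_K\text{ such that }Q\subset R\}$. An exclusion set is a set of nodes excluded from the actuator set. Directed graph $\mathcal{H}_r(S)$ for $S\subset V$: let $V'=\{v_1',\dots,v_n'\}$, $V''=\{v_1'',\dots,v_n''\}$ be disjoint copies of $V$ and $S''\subset V''$ the copy of $S$. The nodes are $V\cup S''\cup V'$ together with three extra nodes $s$ (source), $t$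 (sink) and $s''$. The directed edges are: $v_i\to v_j'$ whenever $(v_i,v_j)\in E$; $v_k''\to v_k'$ whenever $v_k\in S$; $s\to v$ for all $v\in V$; $s\to s''$; $s''\to w$ for all $w\in S''$; and $v'\to t$ for all $v'\in V'$. The capacity function $c$ equals $1$ on every edge except $c(s,s'')=K$. A flow in $(D,c,s,t)$ is a function $g$ from the edges of $D$ to the nonnegative reals with $\sum_u g(u,w)=\sum_v g(w,v)$ for every node $w\ne s,t$, and $g(u,v)\le c(u,v)$ for every edge $(u,v)$; its value is $\mathrm{val}(g)=\sum_w g(s,w)$.
   Formalization: The formal theorem additionally assumes K ≥ 1 and K ≤ |V∖R|; without these the equivalence fails, e.g. for n=1, A=[1] with K=0, R=∅, or with K=1, R=V, where a flow of value n exists but R is not in R̃_K. *)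

theory Defs
  imports
    Complex_Main
    "Graph_Theory.Digraph_Component"
    "Graph_Theory.Pair_Digraph"
    "Jordan_Normal_Form.DL_Rank"
begin

text \<open>The nodes \<open>v\<^sub>1, \<dots>, v\<^sub>n\<close> are represented by the row indices \<open>0, \<dots>, n - 1\<close> of an
  \<open>n \<times> n\<close> matrix.\<close>

text \<open>The arc \<open>(j, i)\<close> stems from the entry in row \<open>i\<close> and column \<open>j\<close>: state \<open>j\<close> influences
  state \<open>i\<close>.\<close>

definition digraph_of :: "nat \<Rightarrow> real mat \<Rightarrow> nat pair_pre_digraph" where
  "digraph_of n A =
     \<lparr> pverts = {0..<n},
       parcs = {(j, i) | i j. i < n \<and> j < n \<and> A $$ (i, j) \<noteq> 0} \<rparr>"

definition actuator_mat :: "nat \<Rightarrow> nat set \<Rightarrow> real mat" where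
  "actuator_mat n S = mat n n (\<lambda>(i, j). if i = j \<and> i \<in> S then 1 else 0)"

text \<open>The \<open>n \<times> n\<^sup>2\<close> block matrix \<open>[B  AB  \<dots>  A\<^sup>n\<^sup>-\<^sup>1B]\<close>: column \<open>c\<close> is column \<open>c mod n\<close> of block
  number \<open>c div n\<close>.\<close>

definition controllability_mat :: "nat \<Rightarrow> real mat \<Rightarrow> real mat \<Rightarrow> real mat" where
  "controllability_mat n A B =
     mat n (n * n) (\<lambda>(i, c). (A ^\<^sub>m (c div n) * B) $$ (i, c mod n))"

definition controllable :: "nat \<Rightarrow> real mat \<Rightarrow> real mat \<Rightarrow> bool" where
  "controllable n A B \<longleftrightarrow> vec_space.rank n (controllability_mat n A B) = n"

definition same_zeros :: "nat \<Rightarrow> real mat \<Rightarrow> real mat \<Rightarrow> bool" where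
  "same_zeros n M N \<longleftrightarrow> (\<forall>i<n. \<forall>j<n. M $$ (i, j) = 0 \<longleftrightarrow> N $$ (i, j) = 0)"

definition structurally_controllable :: "nat \<Rightarrow> real mat \<Rightarrow> real mat \<Rightarrow> bool" where
  "structurally_controllable n A B \<longleftrightarrow>
     (\<exists>A' \<in> carrier_mat n n. \<exists>B' \<in> carrier_mat n n.
        same_zeros n A' A \<and> same_zeros n B' B \<and> controllable n A' B')"

definition actuator_sets :: "nat \<Rightarrow> real mat \<Rightarrow> nat \<Rightarrow> nat set set" where
  "actuator_sets n A K =
     {S. S \<subseteq> {0..<n} \<and> card S = K \<and> structurally_controllable n A (actuator_mat n S)}"

definition complement_sets :: "nat \<Rightarrow> real mat \<Rightarrow> nat \<Rightarrow> nat set set" where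
  "complement_sets n A K = {R. R \<subseteq> {0..<n} \<and> {0..<n} - R \<in> actuator_sets n A K}"

definition feasible_exclusions :: "nat \<Rightarrow> real mat \<Rightarrow> nat \<Rightarrow> nat set set" where
  "feasible_exclusions n A K = {Q. \<exists>R \<in> complement_sets n A K. Q \<subseteq> R}"

definition is_flow ::
    "('v, 'e) pre_digraph \<Rightarrow> ('e \<Rightarrow> real) \<Rightarrow> 'v \<Rightarrow> 'v \<Rightarrow> ('e \<Rightarrow> real) \<Rightarrow> bool" where
  "is_flow D c s t g \<longleftrightarrow>
     (\<forall>e \<in> arcs D. 0 \<le> g e \<and> g e \<le> c e) \<and>
     (\<forall>w \<in> verts D - {s, t}. (\<Sum>e \<in> in_arcs D w. g e) = (\<Sum>e \<in> out_arcs D w. g e))"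

definition flow_value :: "('v, 'e) pre_digraph \<Rightarrow> 'v \<Rightarrow> ('e \<Rightarrow> real) \<Rightarrow> real" where
  "flow_value D s g = (\<Sum>e \<in> out_arcs D s. g e)"

text \<open>\<open>Orig i\<close>, \<open>Single i\<close> and \<open>Double i\<close> stand for \<open>v\<^sub>i\<close> and its copies \<open>v\<^sub>i'\<close> and \<open>v\<^sub>i''\<close>;
  \<open>Gate\<close> stands for \<open>s''\<close>.\<close>

datatype hnode = Orig nat | Single nat | Double nat | Source | Sink | Gate

definition flow_net :: "nat \<Rightarrow> real mat \<Rightarrow> nat set \<Rightarrow> hnode pair_pre_digraph" where
  "flow_net n A S =
     \<lparr> pverts = Orig ` {0..<n} \<union> Double ` S \<union> Single ` {0..<n} \<union> {Source, Sink, Gate},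
       parcs =
         {(Orig i, Single j) | i j. (i, j) \<in> parcs (digraph_of n A)} \<union>
         {(Double k, Single k) | k. k \<in> S} \<union>
         {(Source, Orig i) | i. i \<in> {0..<n}} \<union>
         {(Source, Gate)} \<union>
         {(Gate, Double k) | k. k \<in> S} \<union>
         {(Single i, Sink) | i. i \<in> {0..<n}} \<rparr>"

definition net_capacity :: "nat \<Rightarrow> hnode \<times> hnode \<Rightarrow> real" where
  "net_capacity K e = (if e = (Source, Gate) then real K else 1)"

end

theory Submission
  imports Defs
begin

text \<open>
  Two facts about a set \<open>S\<close> of actuated nodes are combined.

  For a strongly connected digraph and \<open>S \<noteq> {}\<close>, structural controllability is equivalent to a matching
  in which every row of \<open>[A B(S)]\<close> gets its own column with a nonzero entry. The matching is necessary
  by \<open>controllable_imp_hall_condition\<close>: a violation of Hall's condition gives a vector that annihilates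
  \<open>[A B]\<close>, and hence the whole controllability matrix. It is sufficient by
  \<open>structurally_controllable_of_matching\<close>. The matching yields a permutation \<open>\<sigma>\<close> all of whose edges are
  edges of the digraph or end in \<open>S\<close>. The cycles of \<open>\<sigma>\<close> through \<open>S\<close> are controllable. Any further cycle
  is entered by an edge from a controlled node, and becomes controlled if its weight is large enough
  (\<open>controls_add_cycle\<close>), because the dynamics of the cycle are then separated from those of the rest.
  Rows at actuated nodes are irrelevant (\<open>controls_drop_actuated_rows\<close>), and controllability survives
  the small perturbation that produces the zero pattern of \<open>A\<close> (\<open>controls_full_pattern\<close>).

  A flow of value \<open>n\<close> is a fractional version of such a matching, in which only nodes outside \<open>R\<close> are
  matched to actuators, with total weight at most \<open>K\<close>. A matching is in particular a fractional one.
  Conversely, a fractional matching implies Hall's condition when \<open>K\<close> dummy columns represent the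
  actuators (\<open>fractional_matching_hall_condition\<close>), so an integral matching with at most \<open>K\<close> actuated
  nodes exists. These nodes extend to an actuator set of \<open>K\<close> nodes that avoids \<open>R\<close>.
\<close>

section \<open>Hall's marriage theorem and linear systems\<close>

text \<open>The induction of Halmos and Vaughan. If some proper nonempty part \<open>X\<close> of the index set is tight, then
\<open>X\<close> and the rest can be matched separately, the rest after removal of all neighbours of \<open>X\<close>. If no
such part is tight, then every proper nonempty part has a neighbour to spare, so any one index can be matched
arbitrarily.\<close>

lemma hall:
  fixes \<Gamma> :: "'a \<Rightarrow> 'b set"
  assumes "finite I"
    and "\<And>i. i \<in> I \<Longrightarrow> finite (\<Gamma> i)"
    and "\<And>X. X \<subseteq> I \<Longrightarrow> card X \<le> card (\<Union>i\<in>X. \<Gamma> i)"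
  shows "\<exists>f. inj_on f I \<and> (\<forall>i\<in>I. f i \<in> \<Gamma> i)"
  using assms
proof (induction I arbitrary: \<Gamma> rule: finite_psubset_induct)
  case (psubset I)
  note fin = psubset.prems(1) and hall = psubset.prems(2)
  show ?case
  proof (cases "\<exists>X. X \<subset> I \<and> X \<noteq> {} \<and> card (\<Union>i\<in>X. \<Gamma> i) = card X")
    case True
    then obtain X where X: "X \<subset> I" "X \<noteq> {}" and tight: "card (\<Union>i\<in>X. \<Gamma> i) = card X"
      by blast
    have "\<exists>f. inj_on f X \<and> (\<forall>i\<in>X. f i \<in> \<Gamma> i)"
      by (rule psubset.IH[OF X(1)]) (use X fin hall in auto)
    then obtain f where f: "inj_on f X" "\<And>i. i \<in> X \<Longrightarrow> f i \<in> \<Gamma> i"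
      by blast
    have "\<exists>g. inj_on g (I - X) \<and> (\<forall>i\<in>I - X. g i \<in> \<Gamma> i - (\<Union>i\<in>X. \<Gamma> i))"
    proof (rule psubset.IH)
      show "I - X \<subset> I"
        using X by blast
      show "finite (\<Gamma> i - (\<Union>i\<in>X. \<Gamma> i))" if "i \<in> I - X" for i
        using that fin by simp
      show "card Y \<le> card (\<Union>i\<in>Y. \<Gamma> i - (\<Union>i\<in>X. \<Gamma> i))" if Y: "Y \<subseteq> I - X" for Y
      proof -
        have "card Y + card X = card (Y \<union> X)"
          using Y X psubset.hyps(1) by (subst card_Un_disjoint) (auto intro: finite_subset)
        also have "\<dots> \<le> card (\<Union>i\<in>Y \<union> X. \<Gamma> i)"
          using Y X by (intro hall) auto
        also have "(\<Union>i\<in>Y \<union> X. \<Gamma> i) = (\<Union>i\<in>Y. \<Gamma> i - (\<Union>i\<in>X. \<Gamma> i)) \<union> (\<Union>i\<in>X. \<Gamma> i)"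
          by auto
        also have "card \<dots> \<le> card (\<Union>i\<in>Y. \<Gamma> i - (\<Union>i\<in>X. \<Gamma> i)) + card (\<Union>i\<in>X. \<Gamma> i)"
          by (rule card_Un_le)
        finally show ?thesis
          using tight by simp
      qed
    qed
    then obtain g where g: "inj_on g (I - X)"
      "\<And>i. i \<in> I - X \<Longrightarrow> g i \<in> \<Gamma> i - (\<Union>i\<in>X. \<Gamma> i)"
      by blast
    define h where "h i = (if i \<in> X then f i else g i)" for i
    have "inj_on h I"
    proof (rule inj_onI)
      fix i j
      assume ij: "i \<in> I" "j \<in> I" "h i = h j"
      show "i = j"
      proof (cases "i \<in> X"; cases "j \<in> X")
        assume "i \<in> X" "j \<in> X"
        then show ?thesis using ij f(1) by (simp add: h_def inj_on_eq_iff)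
      next
        assume "i \<notin> X" "j \<notin> X"
        then show ?thesis using ij g(1) by (simp add: h_def inj_on_eq_iff)
      next
        assume a: "i \<in> X" "j \<notin> X"
        then have "g j = f i" using ij by (simp add: h_def)
        then show ?thesis using a f(2)[of i] g(2)[of j] ij by auto
      next
        assume a: "i \<notin> X" "j \<in> X"
        then have "g i = f j" using ij by (simp add: h_def)
        then show ?thesis using a f(2)[of j] g(2)[of i] ij by auto
      qed
    qed
    moreover have "\<forall>i\<in>I. h i \<in> \<Gamma> i"
      using f(2) g(2) by (auto simp: h_def)
    ultimately show ?thesis
      by blast
  next
    case not_tight: False
    show ?thesis
    proof (cases "I = {}")
      case True
      then show ?thesis by simp
    next
      case nonempty: False
      then obtain k where k: "k \<in> I"
        by blast
      have "card {k} \<le> card (\<Union>i\<in>{k}. \<Gamma> i)"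
        using k by (intro hall) simp
      then obtain y where y: "y \<in> \<Gamma> k"
        by fastforce
      have "\<exists>g. inj_on g (I - {k}) \<and> (\<forall>i\<in>I - {k}. g i \<in> \<Gamma> i - {y})"
      proof (rule psubset.IH)
        show "I - {k} \<subset> I"
          using k by blast
        show "finite (\<Gamma> i - {y})" if "i \<in> I - {k}" for i
          using that fin by simp
        show "card Y \<le> card (\<Union>i\<in>Y. \<Gamma> i - {y})" if Y: "Y \<subseteq> I - {k}" for Y
        proof (cases "Y = {}")
          case False
          have sub: "Y \<subset> I" using Y k by blast
          have "card (\<Union>i\<in>Y. \<Gamma> i) \<noteq> card Y"
            using not_tight sub False by blast
          moreover have "card Y \<le> card (\<Union>i\<in>Y. \<Gamma> i)"
            using sub by (intro hall) auto
          ultimately have "card Y \<le> card (\<Union>i\<in>Y. \<Gamma> i) - 1"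
            by simp
          also have "\<dots> \<le> card ((\<Union>i\<in>Y. \<Gamma> i) - {y})"
            by (simp add: card_Diff_singleton_if)
          also have "(\<Union>i\<in>Y. \<Gamma> i) - {y} = (\<Union>i\<in>Y. \<Gamma> i - {y})"
            by auto
          finally show ?thesis .
        qed simp
      qed
      then obtain g where g: "inj_on g (I - {k})" "\<And>i. i \<in> I - {k} \<Longrightarrow> g i \<in> \<Gamma> i - {y}"
        by blast
      have "inj_on (g(k := y)) I"
        using g by (auto simp: inj_on_def)
      moreover have "\<forall>i\<in>I. (g(k := y)) i \<in> \<Gamma> i"
        using g y by auto
      ultimately show ?thesis
        by blast
    qed
  qed
qed

text \<open>Gaussian elimination: solve one equation for one of the unknowns that occur in it and substitute.\<close>

lemma underdetermined:
  fixes a :: "'i \<Rightarrow> 'j \<Rightarrow> real"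
  assumes "finite N" "finite X" "card N < card X"
  shows "\<exists>x. (\<exists>i\<in>X. x i \<noteq> 0) \<and> (\<forall>j\<in>N. (\<Sum>i\<in>X. x i * a i j) = 0)"
  using assms
proof (induction N arbitrary: X a rule: finite_induct)
  case empty
  then have "X \<noteq> {}" by auto
  then show ?case by (intro exI[of _ "\<lambda>_. 1"]) auto
next
  case (insert j N)
  show ?case
  proof (cases "\<forall>i\<in>X. a i j = 0")
    case True
    have "card N < card X"
      using insert by simp
    then obtain x where "\<exists>i\<in>X. x i \<noteq> 0" "\<forall>l\<in>N. (\<Sum>i\<in>X. x i * a i l) = 0"
      using insert.IH[OF insert.prems(1)] by blast
    then show ?thesis
      using True by (intro exI[of _ x]) auto
  next
    case False
    then obtain p where p: "p \<in> X" "a p j \<noteq> 0" by blast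
    define Y where "Y = X - {p}"
    have Y: "X = insert p Y" "p \<notin> Y" "finite Y"
      using p insert.prems by (auto simp: Y_def)
    define b where "b i l = a i l - a i j / a p j * a p l" for i l
    have "card N < card Y"
      using insert Y by simp
    then obtain x where x: "\<exists>i\<in>Y. x i \<noteq> 0" "\<forall>l\<in>N. (\<Sum>i\<in>Y. x i * b i l) = 0"
      using insert.IH[OF Y(3), of b] by blast
    define r where "r = (\<Sum>i\<in>Y. x i * a i j) / a p j"
    define z where "z = x(p := - r)"
    have z: "(\<Sum>i\<in>X. z i * a i l) = (\<Sum>i\<in>Y. x i * a i l) - r * a p l" for l
    proof -
      have "(\<Sum>i\<in>Y. z i * a i l) = (\<Sum>i\<in>Y. x i * a i l)"
        using Y by (intro sum.cong) (auto simp: z_def)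
      then show ?thesis
        using Y by (simp add: z_def)
    qed
    have b: "(\<Sum>i\<in>Y. x i * b i l) = (\<Sum>i\<in>Y. x i * a i l) - r * a p l" for l
      by (simp add: b_def r_def algebra_simps sum_subtractf sum_distrib_left sum_divide_distrib)
    have "(\<Sum>i\<in>X. z i * a i j) = 0"
      using p by (simp add: z r_def)
    moreover have "(\<Sum>i\<in>X. z i * a i l) = 0" if "l \<in> N" for l
      using x(2) that z b by simp
    moreover have "\<exists>i\<in>X. z i \<noteq> 0"
      using x(1) Y by (auto simp: z_def)
    ultimately show ?thesis
      by (intro exI[of _ z]) auto
  qed
qed

text \<open>A vector lies in the span of finitely many vectors unless a linear functional separates it from them.
Suppose that \<open>v\<close> separates \<open>e\<close> from the old family but not from the new vector \<open>X m\<close>. Subtracting a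
multiple of \<open>X m\<close> from \<open>e\<close> makes its value under \<open>v\<close> zero. If the difference is in the span of the old
family, then \<open>e\<close> is in the span of the new one, and a functional that separates the difference can be
corrected by a multiple of \<open>v\<close>.\<close>

lemma fredholm_alternative:
  fixes X :: "'i \<Rightarrow> 'j \<Rightarrow> real"
  assumes "finite I" "finite J"
  shows "(\<exists>c. \<forall>j\<in>J. e j = (\<Sum>i\<in>I. c i * X i j)) \<or>
         (\<exists>v. (\<forall>i\<in>I. (\<Sum>j\<in>J. v j * X i j) = 0) \<and> (\<Sum>j\<in>J. v j * e j) = 1)"
  using assms(1)
proof (induction I arbitrary: e rule: finite_induct)
  case empty
  show ?case
  proof (cases "\<forall>j\<in>J. e j = 0")
    case False
    then obtain k where k: "k \<in> J" "e k \<noteq> 0" by blast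
    define v where "v j = (if j = k then 1 / e k else 0)" for j
    have "(\<Sum>j\<in>J. v j * e j) = (\<Sum>j\<in>J. if j = k then 1 else 0)"
      using k by (intro sum.cong) (auto simp: v_def)
    then have "(\<Sum>j\<in>J. v j * e j) = 1"
      using k assms(2) by simp
    then show ?thesis by auto
  qed simp
next
  case (insert m I)
  from insert.IH[of e] show ?case
  proof (elim disjE exE conjE)
    fix c
    assume "\<forall>j\<in>J. e j = (\<Sum>i\<in>I. c i * X i j)"
    then have "\<forall>j\<in>J. e j = (\<Sum>i\<in>insert m I. (c(m := 0)) i * X i j)"
      using insert.hyps by (auto intro!: sum.cong)
    then show ?thesis by blast
  next
    fix v
    assume v: "\<forall>i\<in>I. (\<Sum>j\<in>J. v j * X i j) = 0" "(\<Sum>j\<in>J. v j * e j) = 1"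
    define r where "r = (\<Sum>j\<in>J. v j * X m j)"
    show ?thesis
    proof (cases "r = 0")
      case True
      then show ?thesis using v r_def by auto
    next
      case False
      from insert.IH[of "\<lambda>j. e j - X m j / r"] show ?thesis
      proof (elim disjE exE conjE)
        fix c
        assume c: "\<forall>j\<in>J. e j - X m j / r = (\<Sum>i\<in>I. c i * X i j)"
        have "e j = (\<Sum>i\<in>insert m I. (c(m := 1 / r)) i * X i j)" if "j \<in> J" for j
        proof -
          have "(\<Sum>i\<in>I. (c(m := 1 / r)) i * X i j) = (\<Sum>i\<in>I. c i * X i j)"
            using insert.hyps by (intro sum.cong) auto
          then show ?thesis
            using insert.hyps c that by (simp add: algebra_simps)
        qed
        then show ?thesis by blast
      next
        fix u
        assume u: "\<forall>i\<in>I. (\<Sum>j\<in>J. u j * X i j) = 0" "(\<Sum>j\<in>J. u j * (e j - X m j / r)) = 1"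
        define q where "q = (\<Sum>j\<in>J. u j * X m j)"
        \<comment> \<open>the multiple of \<open>v\<close> is chosen so that \<open>z\<close> annihilates \<open>X m\<close>\<close>
        define z where "z j = u j - q / r * v j" for j
        have z: "(\<Sum>j\<in>J. z j * y j) = (\<Sum>j\<in>J. u j * y j) - q / r * (\<Sum>j\<in>J. v j * y j)" for y
          by (simp add: z_def algebra_simps sum_subtractf sum_distrib_left)
        have "(\<Sum>j\<in>J. u j * (e j - X m j / r)) = (\<Sum>j\<in>J. u j * e j) - q / r"
          by (simp add: q_def algebra_simps sum_subtractf sum_divide_distrib)
        then have "(\<Sum>j\<in>J. z j * e j) = 1"
          using u(2) v(2) by (simp add: z)
        moreover have "(\<Sum>j\<in>J. z j * X m j) = 0"
          using False by (simp add: z q_def[symmetric] r_def[symmetric])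
        ultimately show ?thesis
          using u(1) v(1) by (intro disjI2 exI[of _ z]) (auto simp: z)
      qed
    qed
  qed
qed

section \<open>Controllability in dual form\<close>

text \<open>Matrices and vectors are functions of which only the values at arguments below \<open>n\<close> are relevant. The
control direction of an actuated node \<open>s\<close> is the coordinate vector \<open>unit s\<close>.\<close>

definition mv :: "nat \<Rightarrow> (nat \<Rightarrow> nat \<Rightarrow> real) \<Rightarrow> (nat \<Rightarrow> real) \<Rightarrow> nat \<Rightarrow> real" where
  "mv n a x i = (\<Sum>j<n. a i j * x j)"

definition dot :: "nat \<Rightarrow> (nat \<Rightarrow> real) \<Rightarrow> (nat \<Rightarrow> real) \<Rightarrow> real" where
  "dot n v x = (\<Sum>i<n. v i * x i)"

definition unit :: "nat \<Rightarrow> nat \<Rightarrow> real" where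
  "unit s i = (if i = s then 1 else 0)"

text \<open>The dual of reachability: a functional that vanishes on all states that can be reached from the
actuated nodes \<open>S\<close> must vanish at the nodes of \<open>U\<close>. Allowing \<open>U\<close> to be smaller than the set of all
nodes is what makes an induction on \<open>U\<close> possible.\<close>

definition controls :: "nat \<Rightarrow> (nat \<Rightarrow> nat \<Rightarrow> real) \<Rightarrow> nat set \<Rightarrow> nat set \<Rightarrow> bool" where
  "controls n a S U \<longleftrightarrow>
     (\<forall>v. (\<forall>k. \<forall>s\<in>S. dot n v ((mv n a ^^ k) (unit s)) = 0) \<longrightarrow> (\<forall>i\<in>U. v i = 0))"

lemma mv_cong: "(\<And>j. j < n \<Longrightarrow> x j = y j) \<Longrightarrow> mv n a x = mv n a y"
  by (auto simp: mv_def fun_eq_iff intro!: sum.cong)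

lemma mv_sum: "mv n a (\<lambda>i. \<Sum>t\<in>T. c t * x t i) = (\<lambda>i. \<Sum>t\<in>T. c t * mv n a (x t) i)"
proof
  fix i
  have "mv n a (\<lambda>i. \<Sum>t\<in>T. c t * x t i) i = (\<Sum>j<n. \<Sum>t\<in>T. c t * (a i j * x t j))"
    unfolding mv_def sum_distrib_left by (intro sum.cong refl mult.left_commute)
  also have "\<dots> = (\<Sum>t\<in>T. \<Sum>j<n. c t * (a i j * x t j))"
    by (rule sum.swap)
  finally show "mv n a (\<lambda>i. \<Sum>t\<in>T. c t * x t i) i = (\<Sum>t\<in>T. c t * mv n a (x t) i)"
    by (simp add: mv_def sum_distrib_left)
qed

lemma mv_add: "mv n a (\<lambda>i. x i + y i) = (\<lambda>i. mv n a x i + mv n a y i)"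
  by (simp add: fun_eq_iff mv_def distrib_left sum.distrib)

lemma mv_pow_sum:
  "(mv n a ^^ k) (\<lambda>i. \<Sum>t\<in>T. c t * x t i) = (\<lambda>i. \<Sum>t\<in>T. c t * (mv n a ^^ k) (x t) i)"
  by (induction k) (simp_all add: mv_sum)

lemma mv_pow_cong:
  "(\<And>j. j < n \<Longrightarrow> x j = y j) \<Longrightarrow> i < n \<Longrightarrow> (mv n a ^^ k) x i = (mv n a ^^ k) y i"
proof (induction k arbitrary: i)
  case (Suc k)
  then show ?case
    using mv_cong[of n "(mv n a ^^ k) x" "(mv n a ^^ k) y" a] by simp
qed simp

lemma dot_cong: "(\<And>j. j < n \<Longrightarrow> x j = y j) \<Longrightarrow> dot n v x = dot n v y"
  by (auto simp: dot_def intro!: sum.cong)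

lemma dot_add: "dot n v (\<lambda>i. x i + y i) = dot n v x + dot n v y"
  by (simp add: dot_def algebra_simps sum.distrib)

lemma dot_sum: "dot n v (\<lambda>i. \<Sum>t\<in>T. c t * x t i) = (\<Sum>t\<in>T. c t * dot n v (x t))"
proof -
  have "dot n v (\<lambda>i. \<Sum>t\<in>T. c t * x t i) = (\<Sum>j<n. \<Sum>t\<in>T. c t * (v j * x t j))"
    unfolding dot_def sum_distrib_left by (intro sum.cong refl mult.left_commute)
  also have "\<dots> = (\<Sum>t\<in>T. \<Sum>j<n. c t * (v j * x t j))"
    by (rule sum.swap)
  finally show ?thesis
    by (simp add: dot_def sum_distrib_left)
qed

lemma dot_unit: "s < n \<Longrightarrow> dot n v (unit s) = v s"
  by (simp add: dot_def unit_def if_distrib[of "(*) _"] cong: if_cong)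

lemma unit_dot: "s < n \<Longrightarrow> dot n (unit s) x = x s"
  by (simp add: dot_def unit_def if_distrib[of "\<lambda>z. z * _"] cong: if_cong)

lemma mv_unit: "s < n \<Longrightarrow> mv n a (unit s) i = a i s"
  by (simp add: mv_def unit_def if_distrib[of "(*) _"] cong: if_cong)

lemma dot_mv: "dot n v (mv n a x) = dot n (\<lambda>j. \<Sum>i<n. v i * a i j) x"
proof -
  have "dot n v (mv n a x) = (\<Sum>i<n. \<Sum>j<n. v i * a i j * x j)"
    unfolding dot_def mv_def sum_distrib_left by (intro sum.cong refl mult.assoc[symmetric])
  also have "\<dots> = (\<Sum>j<n. \<Sum>i<n. v i * a i j * x j)"
    by (rule sum.swap)
  finally show ?thesis
    by (simp add: dot_def sum_distrib_right)
qed

text \<open>The \<open>n + 1\<close> vectors \<open>x, a x, \<dots>, a\<^sup>n x\<close> of dimension \<open>n\<close> are linearly dependent. Normalising the highest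
nonzero coefficient and applying \<open>a\<^sup>d\<close> gives a recurrence along the whole orbit of \<open>x\<close>, which stands in
for the theorem of Cayley and Hamilton.\<close>

lemma krylov_relation:
  "\<exists>L c. L \<le> n \<and> c L = 1 \<and> (\<forall>d. \<forall>i<n. (\<Sum>l\<le>L. c l * (mv n a ^^ (l + d)) x i) = 0)"
proof -
  obtain y where y: "\<exists>l\<in>{..n}. y l \<noteq> 0"
      "\<forall>i\<in>{..<n}. (\<Sum>l\<le>n. y l * (mv n a ^^ l) x i) = 0"
    using underdetermined[of "{..<n}" "{..n}" "\<lambda>l i. (mv n a ^^ l) x i"] by auto
  define L where "L = Max {l. l \<le> n \<and> y l \<noteq> 0}"
  have "L \<in> {l. l \<le> n \<and> y l \<noteq> 0}"
    unfolding L_def using y(1) by (intro Max_in) auto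
  then have L: "L \<le> n" "y L \<noteq> 0" by auto
  have top: "y l = 0" if "l \<le> n" "l > L" for l
  proof (rule ccontr)
    assume "y l \<noteq> 0"
    then have "l \<le> L"
      unfolding L_def using that by (intro Max_ge) auto
    then show False using that by simp
  qed
  define c where "c l = y l / y L" for l
  have rel: "(\<Sum>l\<le>L. c l * (mv n a ^^ l) x i) = 0" if "i < n" for i
  proof -
    have "(\<Sum>l\<le>L. y l * (mv n a ^^ l) x i) = (\<Sum>l\<le>n. y l * (mv n a ^^ l) x i)"
      using L top by (intro sum.mono_neutral_left) auto
    then have "(\<Sum>l\<le>L. y l * (mv n a ^^ l) x i) = 0"
      using y(2) that by simp
    then show ?thesis
      by (simp add: c_def flip: sum_divide_distrib)
  qed
  have zero: "mv n a (\<lambda>_. 0) = (\<lambda>_. 0)"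
    by (simp add: mv_def fun_eq_iff)
  have "(\<Sum>l\<le>L. c l * (mv n a ^^ (l + d)) x i) = 0" if "i < n" for d i
  proof -
    have "(mv n a ^^ d) (\<lambda>_. 0) = (\<lambda>_. 0)"
      by (induction d) (simp_all add: zero)
    then have "0 = (mv n a ^^ d) (\<lambda>i. \<Sum>l\<le>L. c l * (mv n a ^^ l) x i) i"
      using mv_pow_cong[of n "\<lambda>i. \<Sum>l\<le>L. c l * (mv n a ^^ l) x i" "\<lambda>_. 0", OF rel that]
      by simp
    also have "\<dots> = (\<Sum>l\<le>L. c l * (mv n a ^^ d) ((mv n a ^^ l) x) i)"
      by (simp add: mv_pow_sum)
    also have "\<dots> = (\<Sum>l\<le>L. c l * (mv n a ^^ (l + d)) x i)"
      by (simp add: funpow_add add.commute[of _ d])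
    finally show ?thesis by simp
  qed
  then show ?thesis
    using L by (intro exI[of _ L] exI[of _ c]) (simp add: c_def)
qed

lemma orbit_vanishes_of_relation:
  assumes "c L = 1"
    and rel: "\<forall>d. \<forall>i<n. (\<Sum>l\<le>L. c l * (mv n a ^^ (l + d)) x i) = 0"
    and low: "\<And>k. k < L \<Longrightarrow> dot n v ((mv n a ^^ k) x) = 0"
  shows "dot n v ((mv n a ^^ k) x) = 0"
proof (induction k rule: less_induct)
  case (less k)
  show ?case
  proof (cases "k < L")
    case False
    have "0 = dot n v (\<lambda>i. \<Sum>l\<le>L. c l * (mv n a ^^ (l + (k - L))) x i)"
      using dot_cong[of n "\<lambda>i. \<Sum>l\<le>L. c l * (mv n a ^^ (l + (k - L))) x i" "\<lambda>_. 0" v] rel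
      by (simp add: dot_def)
    also have "\<dots> = (\<Sum>l\<le>L. c l * dot n v ((mv n a ^^ (l + (k - L))) x))"
      by (rule dot_sum)
    also have "\<dots> = (\<Sum>l\<le>L. if l = L then dot n v ((mv n a ^^ k) x) else 0)"
      using False less assms(1) by (intro sum.cong) auto
    finally show ?thesis by simp
  qed (use low in simp)
qed

text \<open>By this only the first \<open>n\<close> powers matter, which is why the controllability matrix stops at the power
\<open>n - 1\<close>.\<close>

lemma orbit_vanishes_of_below_dim:
  assumes "\<And>k. k < n \<Longrightarrow> dot n v ((mv n a ^^ k) x) = 0"
  shows "dot n v ((mv n a ^^ k) x) = 0"
proof -
  obtain L c where "L \<le> n" "c L = 1"
    "\<forall>d. \<forall>i<n. (\<Sum>l\<le>L. c l * (mv n a ^^ (l + d)) x i) = 0"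
    using krylov_relation[of n a x] by blast
  then show ?thesis
    using assms orbit_vanishes_of_relation[of c L n a x v k] by simp
qed

text \<open>Invariance under state feedback. Rows of \<open>a\<close> at actuated nodes only change a state by multiples of
\<open>unit s\<close> with \<open>s \<in> S\<close>, and those directions are reachable anyway. Hence these rows may be filled with
arbitrary entries during a construction and erased afterwards.\<close>

lemma controls_drop_actuated_rows:
  assumes "controls n a S {..<n}" "S \<subseteq> {..<n}"
  shows "controls n (\<lambda>i j. if i \<in> S then 0 else a i j) S {..<n}"
proof -
  define b where "b i j = (if i \<in> S then 0 else a i j)" for i j
  define N where "N = {v. \<forall>k. \<forall>s\<in>S. dot n v ((mv n b ^^ k) (unit s)) = 0}"
  \<comment> \<open>\<open>W\<close> is the reachable space of \<open>b\<close>, as the double annihilator; it turns out to be invariant under \<open>a\<close>\<close>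
  define W where "W = {x. \<forall>v\<in>N. dot n v x = 0}"
  have N_S: "v s = 0" if "v \<in> N" "s \<in> S" for v s
  proof -
    have "dot n v ((mv n b ^^ 0) (unit s)) = 0"
      using that unfolding N_def by blast
    then show ?thesis using that assms(2) by (simp add: dot_unit subset_iff)
  qed
  have W_b: "mv n b x \<in> W" if x: "x \<in> W" for x
  proof -
    have "dot n v (mv n b x) = 0" if v: "v \<in> N" for v
    proof -
      have "dot n (\<lambda>j. \<Sum>i<n. v i * b i j) ((mv n b ^^ k) (unit s)) = 0" if "s \<in> S" for k s
      proof -
        have "dot n v ((mv n b ^^ Suc k) (unit s)) = 0"
          using v that unfolding N_def by blast
        then show ?thesis by (simp add: dot_mv)
      qed
      then have "(\<lambda>j. \<Sum>i<n. v i * b i j) \<in> N"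
        by (simp add: N_def)
      then show ?thesis
        using x by (simp add: dot_mv W_def)
    qed
    then show ?thesis by (simp add: W_def)
  qed
  have W_a: "mv n a x \<in> W" if x: "x \<in> W" for x
  proof -
    have "dot n v (mv n a x) = dot n v (mv n b x)" if "v \<in> N" for v
      using N_S[OF that] by (auto simp: dot_def mv_def b_def intro!: sum.cong)
    then show ?thesis
      using W_b[OF x] by (simp add: W_def)
  qed
  have "unit s \<in> W" if "s \<in> S" for s
    using that N_S assms(2) by (auto simp: W_def dot_unit subset_iff)
  then have "(mv n a ^^ k) (unit s) \<in> W" if "s \<in> S" for k s
    using that by (induction k) (auto intro: W_a)
  then have "\<forall>i<n. v i = 0" if "v \<in> N" for v
    using assms(1) that by (auto simp: controls_def W_def)
  moreover have "(\<lambda>i j. if i \<in> S then 0 else a i j) = b"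
    by (simp add: b_def fun_eq_iff)
  ultimately show ?thesis
    by (simp add: controls_def N_def)
qed

section \<open>Adding a cycle to a controllable set of nodes\<close>

text \<open>If \<open>T\<close> is the shift on periodic sequences, then \<open>H(w T)\<close> is injective for large \<open>w\<close>, because the leading
term of the nonzero polynomial \<open>H\<close> dominates: evaluate at a place where the leading term meets the
maximum of \<open>u\<close>. The bound on \<open>w\<close> depends on \<open>H\<close> only, so \<open>w\<close> can be fixed before the functional whose
values on the cycle form the sequence \<open>u\<close>.\<close>

lemma periodic_annihilator_trivial:
  fixes H :: "nat \<Rightarrow> real"
  assumes "i0 < L" "H i0 \<noteq> 0"
  obtains w :: real where "w > 0"
    "\<And>u m. m > 0 \<Longrightarrow> (\<And>i. u (i + m) = u i) \<Longrightarrow>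
       (\<And>c. (\<Sum>i<L. H i * w ^ i * u (i + c)) = 0) \<Longrightarrow> u = (\<lambda>_::nat. 0)"
proof -
  define D where "D = Max {i. i < L \<and> H i \<noteq> 0}"
  have "D \<in> {i. i < L \<and> H i \<noteq> 0}"
    unfolding D_def using assms by (intro Max_in) auto
  then have D: "D < L" "H D \<noteq> 0" by auto
  have top: "H i = 0" if "i < L" "D < i" for i
  proof (rule ccontr)
    assume "H i \<noteq> 0"
    then have "i \<le> D"
      unfolding D_def using that by (intro Max_ge) auto
    then show False using that by simp
  qed
  define K where "K = (\<Sum>i<L. \<bar>H i\<bar>)"
  have K: "K \<ge> 0" by (simp add: K_def sum_nonneg)
  define w where "w = 1 + K / \<bar>H D\<bar>"
  have w: "w \<ge> 1" using K by (simp add: w_def)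
  have wH: "w * \<bar>H D\<bar> = \<bar>H D\<bar> + K" using D by (simp add: w_def field_simps)
  show ?thesis
  proof (rule that)
    show "w > 0" using w by simp
    fix u :: "nat \<Rightarrow> real" and m :: nat
    assume m: "m > 0" and per: "\<And>i. u (i + m) = u i"
      and eq: "\<And>c. (\<Sum>i<L. H i * w ^ i * u (i + c)) = 0"
    have per': "u (i + m * d) = u i" for i d
    proof (induction d)
      case (Suc d)
      then show ?case using per[of "i + m * d"] by (simp add: add_ac)
    qed simp
    have mod: "u i = u (i mod m)" for i
      using per'[of "i mod m" "i div m"] by simp
    define \<mu> where "\<mu> = Max ((\<lambda>i. \<bar>u i\<bar>) ` {..<m})"
    have bound: "\<bar>u i\<bar> \<le> \<mu>" for i
      unfolding \<mu>_def using m by (subst mod) (intro Max_ge, auto)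
    have "\<mu> \<in> (\<lambda>i. \<bar>u i\<bar>) ` {..<m}"
      unfolding \<mu>_def using m by (intro Max_in) auto
    then obtain i where i: "\<mu> = \<bar>u i\<bar>" by auto
    \<comment> \<open>the summand \<open>m * D\<close> keeps the truncated subtraction exact and does not change \<open>u\<close>\<close>
    define c where "c = i + m * D - D"
    have "D \<le> m * D" using m by simp
    then have "D + c = i + m * D" unfolding c_def by linarith
    then have c: "\<bar>u (D + c)\<bar> = \<mu>" using i per'[of i D] by simp
    have "0 = w * (\<Sum>i<L. H i * w ^ i * u (i + c))"
      using eq by simp
    also have "(\<Sum>i<L. H i * w ^ i * u (i + c)) =
        H D * w ^ D * u (D + c) + (\<Sum>i\<in>{..<L} - {D}. H i * w ^ i * u (i + c))"
      using D by (subst sum.remove[of _ D]) auto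
    finally have "w * (H D * w ^ D * u (D + c)) =
        - (\<Sum>i\<in>{..<L} - {D}. w * (H i * w ^ i * u (i + c)))"
      by (simp add: algebra_simps sum_distrib_left)
    then have "\<bar>w * (H D * w ^ D * u (D + c))\<bar> =
        \<bar>\<Sum>i\<in>{..<L} - {D}. w * (H i * w ^ i * u (i + c))\<bar>"
      by simp
    moreover have "\<bar>w * (H D * w ^ D * u (D + c))\<bar> = w * \<bar>H D\<bar> * w ^ D * \<mu>"
      using w c by (simp add: abs_mult)
    ultimately have "w * \<bar>H D\<bar> * w ^ D * \<mu> =
        \<bar>\<Sum>i\<in>{..<L} - {D}. w * (H i * w ^ i * u (i + c))\<bar>"
      by simp
    also have "\<dots> \<le> (\<Sum>i\<in>{..<L} - {D}. \<bar>w * (H i * w ^ i * u (i + c))\<bar>)"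
      by (rule sum_abs)
    also have "\<dots> \<le> (\<Sum>i\<in>{..<L} - {D}. \<bar>H i\<bar> * (w ^ D * \<mu>))"
    proof (rule sum_mono)
      fix i assume i: "i \<in> {..<L} - {D}"
      show "\<bar>w * (H i * w ^ i * u (i + c))\<bar> \<le> \<bar>H i\<bar> * (w ^ D * \<mu>)"
      proof (cases "i < D")
        case True
        then have "w ^ Suc i \<le> w ^ D"
          using w by (intro power_increasing) auto
        then have "w ^ Suc i * \<bar>u (i + c)\<bar> \<le> w ^ D * \<mu>"
          using w bound by (intro mult_mono) auto
        then have "\<bar>H i\<bar> * (w ^ Suc i * \<bar>u (i + c)\<bar>) \<le> \<bar>H i\<bar> * (w ^ D * \<mu>)"
          by (intro mult_left_mono) auto
        then show ?thesis
          using w by (simp add: abs_mult power_abs algebra_simps)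
      next
        case False
        then show ?thesis using i top by auto
      qed
    qed
    also have "\<dots> \<le> (\<Sum>i<L. \<bar>H i\<bar> * (w ^ D * \<mu>))"
      using w bound[of 0] by (intro sum_mono2) (auto intro!: mult_nonneg_nonneg)
    also have "\<dots> = K * (w ^ D * \<mu>)"
      by (simp add: K_def sum_distrib_right)
    finally have "(\<bar>H D\<bar> + K) * (w ^ D * \<mu>) \<le> K * (w ^ D * \<mu>)"
      using wH by (simp add: mult.assoc)
    then have "\<bar>H D\<bar> * (w ^ D * \<mu>) \<le> 0"
      by (simp add: algebra_simps)
    moreover have "0 < w ^ D"
      using w by simp
    ultimately have "\<mu> \<le> 0"
      using D by (auto simp: mult_le_0_iff)
    show "u = (\<lambda>_. 0)"
    proof
      show "u i = 0" for i
        using bound[of i] \<open>\<mu> \<le> 0\<close> by simp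
    qed
  qed
qed

lemma permutes_returns:
  assumes "\<sigma> permutes {..<n::nat}" "q < n"
  shows "\<exists>m>0. (\<sigma> ^^ m) q = q"
proof -
  have \<sigma>_n: "\<sigma> j < n \<longleftrightarrow> j < n" for j
    using permutes_in_image[OF assms(1), of j] by simp
  have "(\<sigma> ^^ k) q < n" for k
    using assms(2) by (induction k) (auto simp: \<sigma>_n)
  then have "{y. \<exists>k. y = (\<sigma> ^^ k) q} \<subseteq> {..<n}"
    by auto
  then have "finite {y. \<exists>k. y = (\<sigma> ^^ k) q}"
    by (rule finite_subset) simp
  from funpow_inj_finite[OF permutes_inj[OF assms(1)] this] show ?thesis
    by metis
qed

text \<open>The inductive step. Let \<open>M\<close> extend \<open>a\<close> by an edge from the controlled node \<open>p\<close> to \<open>q\<close> and by the cycle of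
\<open>q\<close> with weight \<open>w\<close>. The orbit of \<open>unit s\<close> under \<open>M\<close> is the old orbit \<open>x s\<close> together with what enters the
cycle at \<open>q\<close>, namely the values \<open>x s l p\<close>, transported around the cycle. Combining the orbit with the
coefficients of a linear relation for \<open>x s\<close> cancels the part on \<open>U\<close>, and leaves \<open>H(w T)\<close> applied to the
cycle, where \<open>H\<close> is a nonzero polynomial that does not depend on \<open>w\<close>. For large \<open>w\<close> this operator is injective, so a functional that vanishes on the orbits of \<open>M\<close>
vanishes on the cycle, and then also on \<open>U\<close> because it vanishes on the old orbits.\<close>

lemma controls_add_cycle:
  assumes \<sigma>: "\<sigma> permutes {..<n}"
    and U: "U \<subseteq> {..<n}" "\<sigma> ` U \<subseteq> U"
    and S: "S \<subseteq> U"
    and supp: "\<And>i j. a i j \<noteq> 0 \<Longrightarrow> i \<in> U \<and> j \<in> U"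
    and ctrl: "controls n a S U"
    and p: "p \<in> U"
    and q: "q < n" "q \<notin> U"
    and C_def: "C = range (\<lambda>i. (\<sigma> ^^ i) q)"
  obtains w where
    "controls n (\<lambda>i j. a i j + (if i = q \<and> j = p then 1 else 0) +
        (if j \<in> C \<and> i = \<sigma> j then w else 0)) S (U \<union> C)"
proof -
  obtain m where m: "m > 0" "(\<sigma> ^^ m) q = q"
    using permutes_returns[OF \<sigma> q(1)] by blast
  have per: "(\<sigma> ^^ (i + m)) q = (\<sigma> ^^ i) q" for i
    using m(2) by (simp add: funpow_add)
  have \<sigma>_n: "\<sigma> j < n \<longleftrightarrow> j < n" for j
    using permutes_in_image[OF \<sigma>, of j] by simp
  have C_n: "(\<sigma> ^^ i) q < n" for i
    using q by (induction i) (auto simp: \<sigma>_n)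
  \<comment> \<open>a cycle that meets the invariant set \<open>U\<close> lies in it\<close>
  have C_U: "(\<sigma> ^^ i) q \<notin> U" for i
  proof
    assume i: "(\<sigma> ^^ i) q \<in> U"
    have "(\<sigma> ^^ (k + i)) q \<in> U" for k
      using U(2) i by (induction k) auto
    from this[of "m * i - i"] have "(\<sigma> ^^ (m * i)) q \<in> U"
      using m(1) by simp
    moreover have "(\<sigma> ^^ (m * k)) q = q" for k
      using m(2) by (induction k) (simp_all add: funpow_add)
    ultimately show False using q(2) by simp
  qed
  define x where "x s l = (mv n a ^^ l) (unit s)" for s l
  have x_supp: "x s l i = 0" if "i \<notin> U" "s \<in> S" for s l i
  proof (cases l)
    case 0
    then show ?thesis using that S by (auto simp: x_def unit_def)
  next
    case (Suc k)
    have "a i j = 0" for j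
      using supp that(1) by blast
    then show ?thesis using Suc by (simp add: x_def mv_def)
  qed
  have x_Suc: "x s (Suc l) = mv n a (x s l)" for s l
    by (simp add: x_def)
  have pn: "p < n" using p U by auto
  have "\<exists>s\<in>S. \<exists>l. x s l p \<noteq> 0"
  proof (rule ccontr)
    assume "\<not> (\<exists>s\<in>S. \<exists>l. x s l p \<noteq> 0)"
    then have "\<forall>k. \<forall>s\<in>S. dot n (unit p) ((mv n a ^^ k) (unit s)) = 0"
      using pn by (simp add: unit_dot x_def)
    then have "unit p p = 0"
      using ctrl p unfolding controls_def by blast
    then show False by (simp add: unit_def)
  qed
  then obtain s l0 where s: "s \<in> S" "x s l0 p \<noteq> 0" by blast
  obtain L c where L: "c L = 1"
      "\<forall>d. \<forall>i<n. (\<Sum>l\<le>L. c l * (mv n a ^^ (l + d)) (unit s) i) = 0"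
    using krylov_relation[of n a "unit s"] by blast
  have "\<exists>k<L. x s k p \<noteq> 0"
  proof (rule ccontr)
    assume "\<not> (\<exists>k<L. x s k p \<noteq> 0)"
    then have "dot n (unit p) ((mv n a ^^ k) (unit s)) = 0" if "k < L" for k
      using pn that by (simp add: unit_dot x_def)
    then have "dot n (unit p) ((mv n a ^^ l0) (unit s)) = 0"
      by (rule orbit_vanishes_of_relation[OF L])
    then show False
      using s(2) pn by (simp add: unit_dot x_def)
  qed
  then obtain k1 where k1: "k1 < L" "x s k1 p \<noteq> 0" by blast
  \<comment> \<open>the first time at which \<open>p\<close> is reached from \<open>s\<close>; it determines the leading term of \<open>H\<close>\<close>
  define k where "k = (LEAST k. x s k p \<noteq> 0)"
  have k: "x s k p \<noteq> 0" "\<And>j. j < k \<Longrightarrow> x s j p = 0"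
    unfolding k_def using LeastI[of "\<lambda>k. x s k p \<noteq> 0", OF k1(2)]
    by (auto dest: not_less_Least)
  have kL: "k < L"
    using Least_le[of "\<lambda>k. x s k p \<noteq> 0", OF k1(2)] k1(1) by (simp add: k_def)
  define H where "H r = (\<Sum>l\<le>L. if r < l then c l * x s (l - 1 - r) p else 0)" for r
  have "H (L - 1 - k) = (\<Sum>l\<le>L. if l = L then x s k p else 0)"
    unfolding H_def
  proof (rule sum.cong)
    fix l assume l: "l \<in> {..L}"
    show "(if L - 1 - k < l then c l * x s (l - 1 - (L - 1 - k)) p else 0) =
        (if l = L then x s k p else 0)"
    proof (cases "l = L")
      case True
      then show ?thesis using kL L(1) by (simp add: Suc_diff_Suc)
    next
      case False
      then show ?thesis using l kL by (auto intro!: k(2))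
    qed
  qed simp
  then have H: "H (L - 1 - k) \<noteq> 0" "L - 1 - k < L"
    using k kL by auto
  from periodic_annihilator_trivial[OF H(2), of H, OF H(1)] obtain w :: real where w: "w > 0"
    "\<And>u m. m > 0 \<Longrightarrow> (\<And>i. u (i + m) = u i) \<Longrightarrow>
       (\<And>c. (\<Sum>i<L. H i * w ^ i * u (i + c)) = 0) \<Longrightarrow> u = (\<lambda>_::nat. 0)"
    by blast
  define M where "M i j = a i j + (if i = q \<and> j = p then 1 else 0) +
        (if j \<in> C \<and> i = \<sigma> j then w else 0)" for i j
  have M_C: "mv n M (unit ((\<sigma> ^^ r) q)) = (\<lambda>i. w * unit ((\<sigma> ^^ Suc r) q) i)" for r
  proof
    fix i
    have "mv n M (unit ((\<sigma> ^^ r) q)) i = M i ((\<sigma> ^^ r) q)"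
      using C_n by (rule mv_unit)
    also have "\<dots> = w * unit ((\<sigma> ^^ Suc r) q) i"
      using supp[of i "(\<sigma> ^^ r) q"] C_U[of r] p by (auto simp: M_def C_def unit_def)
    finally show "mv n M (unit ((\<sigma> ^^ r) q)) i = w * unit ((\<sigma> ^^ Suc r) q) i" .
  qed
  have M_U: "mv n M (x t l) = (\<lambda>i. mv n a (x t l) i + x t l p * unit q i)" if "t \<in> S" for t l
  proof
    fix i
    have "M i j * x t l j = a i j * x t l j + (if j = p then x t l p * unit q i else 0)" for j
    proof (cases "j \<in> U")
      case True
      then have "j \<notin> C"
        using C_U unfolding C_def by blast
      then show ?thesis by (simp add: M_def unit_def distrib_right)
    next
      case False
      then show ?thesis using x_supp[OF _ that, of j l] p by auto
    qed
    then show "mv n M (x t l) i = mv n a (x t l) i + x t l p * unit q i"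
      using pn by (simp add: mv_def sum.distrib)
  qed
  have M_pow: "(mv n M ^^ l) (unit t) =
      (\<lambda>i. x t l i + (\<Sum>r<l. w ^ r * x t (l - 1 - r) p * unit ((\<sigma> ^^ r) q) i))"
    if t: "t \<in> S" for t l
  proof (induction l)
    case 0
    then show ?case by (simp add: x_def)
  next
    case (Suc l)
    have "(mv n M ^^ Suc l) (unit t) = mv n M (\<lambda>i. x t l i +
        (\<Sum>r<l. w ^ r * x t (l - 1 - r) p * unit ((\<sigma> ^^ r) q) i))"
      by (simp add: Suc)
    also have "\<dots> = (\<lambda>i. mv n M (x t l) i +
        mv n M (\<lambda>i. \<Sum>r<l. w ^ r * x t (l - 1 - r) p * unit ((\<sigma> ^^ r) q) i) i)"
      by (rule mv_add)
    also have "\<dots> = (\<lambda>i. mv n M (x t l) i +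
        (\<Sum>r<l. w ^ r * x t (l - 1 - r) p * (w * unit ((\<sigma> ^^ Suc r) q) i)))"
      unfolding mv_sum M_C ..
    also have "\<dots> = (\<lambda>i. x t (Suc l) i +
        (\<Sum>r<Suc l. w ^ r * x t (Suc l - 1 - r) p * unit ((\<sigma> ^^ r) q) i))"
      unfolding M_U[OF t] x_Suc sum.lessThan_Suc_shift by (simp add: ac_simps)
    finally show ?case .
  qed
  have "\<forall>i\<in>U \<union> C. v i = 0"
    if v: "\<forall>k. \<forall>s\<in>S. dot n v ((mv n M ^^ k) (unit s)) = 0" for v
  proof -
    define u where "u r = v ((\<sigma> ^^ r) q)" for r
    have dot_C: "dot n v ((mv n M ^^ d) (unit ((\<sigma> ^^ r) q))) = w ^ d * u (r + d)" for d r
    proof -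
      have "(mv n M ^^ d) (unit ((\<sigma> ^^ r) q)) = (\<lambda>i. w ^ d * unit ((\<sigma> ^^ (r + d)) q) i)"
      proof (induction d)
        case (Suc d)
        have "mv n M (\<lambda>i. \<Sum>_\<in>{()}. w ^ d * unit ((\<sigma> ^^ (r + d)) q) i) =
            (\<lambda>i. \<Sum>_\<in>{()}. w ^ d * mv n M (unit ((\<sigma> ^^ (r + d)) q)) i)"
          by (rule mv_sum)
        then show ?case using Suc by (simp add: M_C mult_ac)
      qed simp
      moreover have "dot n v (\<lambda>i. \<Sum>_\<in>{()}. w ^ d * unit ((\<sigma> ^^ (r + d)) q) i) =
          (\<Sum>_\<in>{()}. w ^ d * dot n v (unit ((\<sigma> ^^ (r + d)) q)))"
        by (rule dot_sum)
      ultimately show ?thesis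
        using dot_unit[OF C_n, of v] by (simp add: u_def)
    qed
    have "(\<Sum>r<L. H r * w ^ r * u (r + d)) = 0" for d
    proof -
      \<comment> \<open>the combination of the orbit in which the part on \<open>U\<close> cancels, so that only the cycle remains\<close>
      define z where "z i = (\<Sum>r<L. H r * w ^ r * unit ((\<sigma> ^^ r) q) i)" for i
      have z: "(\<Sum>l\<le>L. c l * (mv n M ^^ l) (unit s) i) = z i" if "i < n" for i
      proof -
        have "(\<Sum>l\<le>L. c l * (mv n M ^^ l) (unit s) i) =
          (\<Sum>l\<le>L. c l * x s l i) +
          (\<Sum>l\<le>L. \<Sum>r<l. c l * (w ^ r * x s (l - 1 - r) p * unit ((\<sigma> ^^ r) q) i))"
          unfolding M_pow[OF s(1)] by (simp add: distrib_left sum.distrib sum_distrib_left)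
        also have "(\<Sum>l\<le>L. c l * x s l i) = 0"
          using L(2)[rule_format, OF that, of 0] by (simp add: x_def)
        also have "(\<Sum>l\<le>L. \<Sum>r<l. c l * (w ^ r * x s (l - 1 - r) p * unit ((\<sigma> ^^ r) q) i)) =
          (\<Sum>l\<le>L. \<Sum>r<L. (if r < l then c l * x s (l - 1 - r) p else 0) *
             (w ^ r * unit ((\<sigma> ^^ r) q) i))"
        proof (rule sum.cong)
          fix l assume l: "l \<in> {..L}"
          have "(\<Sum>r<L. (if r < l then c l * x s (l - 1 - r) p else 0) *
             (w ^ r * unit ((\<sigma> ^^ r) q) i)) =
            (\<Sum>r<l. (if r < l then c l * x s (l - 1 - r) p else 0) *
             (w ^ r * unit ((\<sigma> ^^ r) q) i))"
            using l by (intro sum.mono_neutral_right) auto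
          also have "\<dots> = (\<Sum>r<l. c l * (w ^ r * x s (l - 1 - r) p * unit ((\<sigma> ^^ r) q) i))"
            by (intro sum.cong) auto
          finally show "(\<Sum>r<l. c l * (w ^ r * x s (l - 1 - r) p * unit ((\<sigma> ^^ r) q) i)) =
            (\<Sum>r<L. (if r < l then c l * x s (l - 1 - r) p else 0) *
             (w ^ r * unit ((\<sigma> ^^ r) q) i))" by simp
        qed simp
        also have "\<dots> = (\<Sum>r<L. \<Sum>l\<le>L. (if r < l then c l * x s (l - 1 - r) p else 0) *
             (w ^ r * unit ((\<sigma> ^^ r) q) i))"
          by (rule sum.swap)
        also have "\<dots> = z i"
          unfolding z_def H_def sum_distrib_right by (simp add: mult.assoc)
        finally show ?thesis by simp
      qed
      have "0 = (\<Sum>l\<le>L. c l * dot n v ((mv n M ^^ (d + l)) (unit s)))"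
        using v s(1) by simp
      also have "\<dots> = dot n v (\<lambda>i. \<Sum>l\<le>L. c l * (mv n M ^^ d) ((mv n M ^^ l) (unit s)) i)"
        by (simp add: dot_sum funpow_add)
      also have "\<dots> = dot n v ((mv n M ^^ d) (\<lambda>i. \<Sum>l\<le>L. c l * (mv n M ^^ l) (unit s) i))"
        by (simp add: mv_pow_sum)
      also have "\<dots> = dot n v ((mv n M ^^ d) z)"
        by (intro dot_cong mv_pow_cong z)
      also have "\<dots> = (\<Sum>r<L. H r * w ^ r * dot n v ((mv n M ^^ d) (unit ((\<sigma> ^^ r) q))))"
        unfolding z_def mv_pow_sum dot_sum ..
      also have "\<dots> = w ^ d * (\<Sum>r<L. H r * w ^ r * u (r + d))"
        unfolding dot_C sum_distrib_left by (intro sum.cong refl) (rule mult.left_commute)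
      finally show ?thesis using w(1) by simp
    qed
    then have u: "u = (\<lambda>_. 0)"
      by (intro w(2)[OF m(1)]) (simp_all add: u_def per)
    have "dot n v ((mv n a ^^ l) (unit t)) = 0" if t: "t \<in> S" for l t
    proof -
      have "0 = dot n v ((mv n M ^^ l) (unit t))"
        using v t by simp
      also have "\<dots> = dot n v (x t l) +
          (\<Sum>r<l. w ^ r * x t (l - 1 - r) p * dot n v (unit ((\<sigma> ^^ r) q)))"
        unfolding M_pow[OF t] dot_add dot_sum ..
      also have "\<dots> = dot n v (x t l)"
        using fun_cong[OF u] by (simp add: dot_unit[OF C_n] u_def)
      finally show ?thesis by (simp add: x_def)
    qed
    then have "\<forall>i\<in>U. v i = 0"
      using ctrl by (simp add: controls_def)
    then show ?thesis
      using fun_cong[OF u] by (auto simp: u_def C_def)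
  qed
  then have "controls n M S (U \<union> C)"
    by (simp add: controls_def)
  then show ?thesis
    by (intro that[of w]) (simp add: M_def[abs_def])
qed

section \<open>Growing the controlled set along a permutation\<close>

text \<open>The nodes are covered by the cycles of \<open>\<sigma>\<close>. The cycles through actuated nodes are controlled by the
permutation matrix of \<open>\<sigma>\<close> itself, since \<open>unit s\<close> travels around its cycle. As long as some cycle is
missing, an edge leaves the controlled set, and the cycle of its end point can be added.\<close>

lemma controls_of_permutation:
  assumes \<sigma>: "\<sigma> permutes {..<n}" and S: "S \<subseteq> {..<n}"
    and exit: "\<And>U. S \<subseteq> U \<Longrightarrow> U \<subset> {..<n} \<Longrightarrow> \<exists>p\<in>U. \<exists>q\<in>{..<n} - U. E p q"
  obtains a where "\<And>i j. a i j \<noteq> 0 \<Longrightarrow> E j i \<or> i = \<sigma> j" "controls n a S {..<n}"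
proof -
  define good where "good U \<longleftrightarrow> S \<subseteq> U \<and> U \<subseteq> {..<n} \<and> \<sigma> ` U \<subseteq> U \<and>
    (\<exists>a. (\<forall>i j. a i j \<noteq> 0 \<longrightarrow> i \<in> U \<and> j \<in> U \<and> (E j i \<or> i = \<sigma> j)) \<and> controls n a S U)" for U
  have \<sigma>_n: "\<sigma> j < n \<longleftrightarrow> j < n" for j
    using permutes_in_image[OF \<sigma>, of j] by simp
  have pow_n: "(\<sigma> ^^ k) s < n" if "s < n" for k s
    using that by (induction k) (auto simp: \<sigma>_n)
  define U0 where "U0 = {(\<sigma> ^^ k) s | k s. s \<in> S}"
  have U0: "(\<sigma> ^^ k) s \<in> U0" if "s \<in> S" for k s
    using that unfolding U0_def by blast
  have "good U0"
    unfolding good_def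
  proof (intro conjI exI allI impI)
    show "S \<subseteq> U0"
      using U0[of _ 0] by auto
    show U0_n: "U0 \<subseteq> {..<n}"
      using S pow_n by (auto simp: U0_def)
    show \<sigma>U0: "\<sigma> ` U0 \<subseteq> U0"
    proof clarify
      fix i assume "i \<in> U0"
      then obtain k s where "s \<in> S" "i = (\<sigma> ^^ k) s"
        unfolding U0_def by blast
      then show "\<sigma> i \<in> U0"
        using U0[of s "Suc k"] by simp
    qed
    define a where "a i j = (if j \<in> U0 \<and> i = \<sigma> j then 1 else 0 :: real)" for i j
    show "a i j \<noteq> 0 \<Longrightarrow> j \<in> U0" "a i j \<noteq> 0 \<Longrightarrow> E j i \<or> i = \<sigma> j"
        "a i j \<noteq> 0 \<Longrightarrow> i \<in> U0" for i j
      using \<sigma>U0 by (auto simp: a_def split: if_splits)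
    have pow: "(mv n a ^^ k) (unit s) = unit ((\<sigma> ^^ k) s)" if "s \<in> S" for k s
    proof (induction k)
      case (Suc k)
      have "mv n a (unit ((\<sigma> ^^ k) s)) i = unit ((\<sigma> ^^ Suc k) s) i" for i
        using U0[OF that, of k] U0_n by (subst mv_unit) (auto simp: a_def unit_def)
      then show ?case using Suc by auto
    qed simp
    show "controls n a S U0"
      unfolding controls_def
    proof (intro allI impI ballI)
      fix v i
      assume v: "\<forall>k. \<forall>s\<in>S. dot n v ((mv n a ^^ k) (unit s)) = 0" and "i \<in> U0"
      then obtain k s where ks: "s \<in> S" "i = (\<sigma> ^^ k) s"
        unfolding U0_def by blast
      have "dot n v (unit i) = 0"
        using v ks(1) unfolding ks(2) by (auto simp: pow)
      then show "v i = 0"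
        using \<open>i \<in> U0\<close> U0_n by (subst (asm) dot_unit) auto
    qed
  qed
  moreover have "card U < Suc n" if "good U" for U
    using that card_mono[of "{..<n}" U] by (auto simp: good_def)
  ultimately obtain U where U: "good U" and max: "\<And>W. good W \<Longrightarrow> card W \<le> card U"
    using ex_has_greatest_nat[of good U0 card "Suc n"] by (metis less_imp_le)
  have "U = {..<n}"
  proof (rule ccontr)
    assume "U \<noteq> {..<n}"
    then obtain p q where pq: "p \<in> U" "q < n" "q \<notin> U" "E p q"
      using exit[of U] U unfolding good_def by blast
    obtain a where a: "\<And>i j. a i j \<noteq> 0 \<Longrightarrow> i \<in> U \<and> j \<in> U \<and> (E j i \<or> i = \<sigma> j)"
        "controls n a S U"
      using U unfolding good_def by blast
    have U': "S \<subseteq> U" "U \<subseteq> {..<n}" "\<sigma> ` U \<subseteq> U"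
      using U unfolding good_def by auto
    define C where "C = range (\<lambda>i. (\<sigma> ^^ i) q)"
    have C: "q \<in> C" "C \<subseteq> {..<n}"
      using pow_n[OF pq(2)] rangeI[of "\<lambda>i. (\<sigma> ^^ i) q" 0] by (auto simp: C_def)
    have \<sigma>C: "\<sigma> j \<in> C" if "j \<in> C" for j
    proof -
      from that obtain i where "j = (\<sigma> ^^ i) q"
        by (auto simp: C_def)
      then show ?thesis
        using rangeI[of "\<lambda>i. (\<sigma> ^^ i) q" "Suc i"] by (simp add: C_def)
    qed
    obtain w where w: "controls n (\<lambda>i j. a i j + (if i = q \<and> j = p then 1 else 0) +
        (if j \<in> C \<and> i = \<sigma> j then w else 0)) S (U \<union> C)"
      by (rule controls_add_cycle[OF \<sigma> U'(2,3,1) _ a(2) pq(1-3) C_def]) (use a(1) in blast)+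
    have "good (U \<union> C)"
      unfolding good_def
    proof (intro conjI exI allI impI)
      show "S \<subseteq> U \<union> C" "U \<union> C \<subseteq> {..<n}" "\<sigma> ` (U \<union> C) \<subseteq> U \<union> C"
        using U' C \<sigma>C by auto
      show "controls n (\<lambda>i j. a i j + (if i = q \<and> j = p then 1 else 0) +
          (if j \<in> C \<and> i = \<sigma> j then w else 0)) S (U \<union> C)"
        by (rule w)
      fix i j
      assume "a i j + (if i = q \<and> j = p then 1 else 0) +
          (if j \<in> C \<and> i = \<sigma> j then w else 0) \<noteq> 0"
      then consider "a i j \<noteq> 0" | "i = q" "j = p" | "j \<in> C" "i = \<sigma> j"
        by (auto split: if_splits)
      then have "i \<in> U \<union> C \<and> j \<in> U \<union> C \<and> (E j i \<or> i = \<sigma> j)"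
        using a(1) pq C(1) \<sigma>C by cases blast+
      then show "i \<in> U \<union> C" "j \<in> U \<union> C" "E j i \<or> i = \<sigma> j"
        by auto
    qed
    from max[OF this] have "card (U \<union> C) \<le> card U" .
    moreover have "card U < card (U \<union> C)"
      using U' C pq(3) finite_subset[of "U \<union> C" "{..<n}"]
      by (intro psubset_card_mono) auto
    ultimately show False by simp
  qed
  then show ?thesis
    using U that unfolding good_def by blast
qed

section \<open>Perturbation to the prescribed zero pattern\<close>

text \<open>A matrix near the identity is diagonally dominant, hence invertible: compare at an entry of \<open>v\<close> of
largest absolute value.\<close>

lemma near_identity_annihilator:
  assumes Y: "\<And>i j. i < n \<Longrightarrow> j < n \<Longrightarrow> \<bar>Y i j - unit i j\<bar> < 1 / (real n + 1)"
    and v: "\<And>i. i < n \<Longrightarrow> dot n v (Y i) = 0"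
    and "i < n"
  shows "v i = 0"
proof -
  define \<mu> where "\<mu> = Max ((\<lambda>i. \<bar>v i\<bar>) ` {..<n})"
  have bound: "\<bar>v j\<bar> \<le> \<mu>" if "j < n" for j
    unfolding \<mu>_def using that by (intro Max_ge) auto
  have "\<mu> \<in> (\<lambda>i. \<bar>v i\<bar>) ` {..<n}"
    unfolding \<mu>_def using \<open>i < n\<close> by (intro Max_in) auto
  then obtain m where m: "m < n" "\<mu> = \<bar>v m\<bar>" by auto
  have "(\<Sum>j<n. v j * (Y m j - unit m j)) = dot n v (Y m) - dot n v (unit m)"
    by (simp add: dot_def right_diff_distrib sum_subtractf)
  also have "\<dots> = - v m"
    using v m(1) by (simp add: dot_unit)
  finally have "\<mu> = \<bar>\<Sum>j<n. v j * (Y m j - unit m j)\<bar>"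
    using m(2) by simp
  also have "\<dots> \<le> (\<Sum>j<n. \<bar>v j * (Y m j - unit m j)\<bar>)"
    by (rule sum_abs)
  also have "\<dots> \<le> (\<Sum>j<n. \<mu> * (1 / (real n + 1)))"
  proof (rule sum_mono)
    fix j assume "j \<in> {..<n}"
    then have "\<bar>v j\<bar> \<le> \<mu>" "\<bar>Y m j - unit m j\<bar> \<le> 1 / (real n + 1)"
      using bound Y[OF m(1)] less_imp_le by auto
    then show "\<bar>v j * (Y m j - unit m j)\<bar> \<le> \<mu> * (1 / (real n + 1))"
      unfolding abs_mult using m(2) by (intro mult_mono) auto
  qed
  also have "\<dots> = \<mu> * (real n / (real n + 1))"
    by simp
  finally have "\<mu> * (1 - real n / (real n + 1)) \<le> 0"
    by (simp add: right_diff_distrib)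
  moreover have "1 - real n / (real n + 1) > 0"
    by simp
  ultimately have "\<mu> \<le> 0"
    by (simp add: mult_le_0_iff)
  then show ?thesis
    using bound[OF \<open>i < n\<close>] by simp
qed

text \<open>Controllability is an open condition, so a small positive number can be added to all entries that are
allowed to be nonzero. Openness is seen as follows: each coordinate vector is a fixed linear combination of
finitely many orbit vectors, and the same combination of the perturbed orbit vectors converges to it.\<close>

lemma controls_full_pattern:
  assumes ctrl: "controls n a S {..<n}" and S: "S \<subseteq> {..<n}"
    and P: "\<And>i j. a i j \<noteq> 0 \<Longrightarrow> P i j"
  obtains b where "\<And>i j. i < n \<Longrightarrow> j < n \<Longrightarrow> b i j \<noteq> 0 \<longleftrightarrow> P i j" "controls n b S {..<n}"
proof -
  define I where "I = {..<n} \<times> S"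
  have fin: "finite I"
    using S finite_subset by (auto simp: I_def)
  define b where "b \<epsilon> i j = a i j + (if P i j then \<epsilon> else 0)" for \<epsilon> i j
  define x where "x \<epsilon> t = (mv n (b \<epsilon>) ^^ fst t) (unit (snd t))" for \<epsilon> t
  have b0: "b 0 = a"
    by (simp add: b_def fun_eq_iff)
  have "\<exists>c. \<forall>j\<in>{..<n}. unit i j = (\<Sum>t\<in>I. c t * x 0 t j)" if i: "i < n" for i
  proof (rule ccontr)
    assume "\<not> ?thesis"
    then obtain v where v: "\<forall>t\<in>I. (\<Sum>j<n. v j * x 0 t j) = 0" "(\<Sum>j<n. v j * unit i j) = 1"
      using fredholm_alternative[OF fin finite_lessThan[of n], of "unit i" "x 0"] by blast
    have "dot n v ((mv n a ^^ k) (unit s)) = 0" if s: "s \<in> S" for k s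
    proof (rule orbit_vanishes_of_below_dim)
      fix k assume "k < n"
      then have "(k, s) \<in> I" using s by (simp add: I_def)
      then show "dot n v ((mv n a ^^ k) (unit s)) = 0"
        using v(1) by (fastforce simp: x_def b0 dot_def)
    qed
    then have "v i = 0"
      using ctrl i by (auto simp: controls_def)
    then show False
      using v(2) dot_unit[OF i, of v] by (simp add: dot_def)
  qed
  then obtain c where c: "\<And>i j. i < n \<Longrightarrow> j < n \<Longrightarrow> (\<Sum>t\<in>I. c i t * x 0 t j) = unit i j"
    by (metis lessThan_iff)
  have lim_b: "((\<lambda>\<epsilon>. b \<epsilon> i j) \<longlongrightarrow> b 0 i j) (at_right 0)" for i j
    by (cases "P i j") (auto simp: b_def intro!: tendsto_eq_intros)
  have "((\<lambda>\<epsilon>. (mv n (b \<epsilon>) ^^ k) (unit s) i) \<longlongrightarrow> (mv n (b 0) ^^ k) (unit s) i) (at_right 0)"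
    for k s i
  proof (induction k arbitrary: i)
    case (Suc k)
    show ?case
      unfolding funpow.simps comp_def mv_def by (intro tendsto_intros lim_b) (use Suc in \<open>simp add: mv_def\<close>)
  qed simp
  then have lim_x: "((\<lambda>\<epsilon>. x \<epsilon> t i) \<longlongrightarrow> x 0 t i) (at_right 0)" for t i
    by (simp add: x_def)
  define y where "y \<epsilon> i j = (\<Sum>t\<in>I. c i t * x \<epsilon> t j)" for \<epsilon> i j
  have lim_y: "((\<lambda>\<epsilon>. y \<epsilon> i j) \<longlongrightarrow> unit i j) (at_right 0)" if "i < n" "j < n" for i j
    unfolding y_def c[OF that, symmetric] by (intro tendsto_intros lim_x)
  have near: "\<forall>\<^sub>F \<epsilon> in at_right 0. \<bar>y \<epsilon> i j - unit i j\<bar> < 1 / (real n + 1)"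
    if "i < n" "j < n" for i j
    using tendstoD[OF lim_y[OF that], of "1 / (real n + 1)"] by (simp add: dist_real_def)
  have nonzero: "\<forall>\<^sub>F \<epsilon> in at_right 0. b \<epsilon> i j \<noteq> 0 \<longleftrightarrow> P i j" for i j
  proof (cases "a i j = 0")
    case True
    have "\<forall>\<^sub>F \<epsilon> in at_right (0::real). 0 < \<epsilon>"
      by (rule eventually_at_right_less)
    then show ?thesis
      by eventually_elim (simp add: b_def True)
  next
    case False
    then have "\<forall>\<^sub>F \<epsilon> in at_right 0. b \<epsilon> i j \<noteq> 0"
      using lim_b[of i j] by (intro tendsto_imp_eventually_ne) (auto simp: b0)
    then show ?thesis
      by eventually_elim (use False P in simp)
  qed
  have "\<forall>\<^sub>F \<epsilon> in at_right 0. \<forall>i\<in>{..<n}. \<forall>j\<in>{..<n}.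
      \<bar>y \<epsilon> i j - unit i j\<bar> < 1 / (real n + 1) \<and> (b \<epsilon> i j \<noteq> 0 \<longleftrightarrow> P i j)"
    using near nonzero by (intro eventually_ball_finite ballI eventually_conj) auto
  then have "\<exists>\<epsilon>. \<forall>i\<in>{..<n}. \<forall>j\<in>{..<n}.
      \<bar>y \<epsilon> i j - unit i j\<bar> < 1 / (real n + 1) \<and> (b \<epsilon> i j \<noteq> 0 \<longleftrightarrow> P i j)"
    by (rule eventually_happens'[rotated]) simp
  then obtain \<epsilon> where \<epsilon>: "\<And>i j. i < n \<Longrightarrow> j < n \<Longrightarrow> \<bar>y \<epsilon> i j - unit i j\<bar> < 1 / (real n + 1)"
      "\<And>i j. i < n \<Longrightarrow> j < n \<Longrightarrow> b \<epsilon> i j \<noteq> 0 \<longleftrightarrow> P i j"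
    by auto
  have "controls n (b \<epsilon>) S {..<n}"
    unfolding controls_def
  proof (intro allI impI ballI)
    fix v i
    assume v: "\<forall>k. \<forall>s\<in>S. dot n v ((mv n (b \<epsilon>) ^^ k) (unit s)) = 0" and i: "i \<in> {..<n}"
    have "dot n v (y \<epsilon> i) = 0" for i
    proof -
      have "dot n v (y \<epsilon> i) = (\<Sum>t\<in>I. c i t * dot n v (x \<epsilon> t))"
        unfolding y_def dot_sum ..
      also have "\<dots> = 0"
        using v by (intro sum.neutral) (auto simp: x_def I_def)
      finally show ?thesis .
    qed
    with \<epsilon>(1) show "v i = 0"
      using i by (intro near_identity_annihilator[of n "y \<epsilon>" v i]) auto
  qed
  then show ?thesis
    using that[of "b \<epsilon>"] \<epsilon>(2) by blast
qed

section \<open>The rank of the controllability matrix\<close>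

text \<open>The columns span the whole space unless a functional separates some vector from all of them.\<close>

lemma full_row_rank_iff:
  fixes A :: "real mat"
  assumes A: "A \<in> carrier_mat n m"
  shows "vec_space.rank n A = n \<longleftrightarrow>
    (\<forall>v. (\<forall>c<m. (\<Sum>i<n. v i * A $$ (i, c)) = 0) \<longrightarrow> (\<forall>i<n. v i = 0))"
proof -
  interpret vec_space "TYPE(real)" n .
  have cols: "set (cols A) \<subseteq> carrier_vec n"
    using A cols_dim by blast
  have col_space: "span (set (cols A)) =
      {y \<in> carrier_vec n. \<exists>x\<in>carrier_vec m. A *\<^sub>v x = y}"
    using col_space_eq[OF A] A by (simp add: col_space_def)
  have "rank A = n \<longleftrightarrow> span (set (cols A)) = carrier_vec n"
  proof
    assume rank: "rank A = n"
    obtain W where W: "maximal W (\<lambda>T. T \<subseteq> set (cols A) \<and> lin_indpt T)"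
      using maximal_exists[of "\<lambda>T. T \<subseteq> set (cols A) \<and> lin_indpt T" "card (set (cols A))" "{}"]
      by (meson List.finite_set card_mono empty_iff empty_subsetI finite_lin_indpt2 finite.emptyI rev_finite_subset)
    have card: "card W = n"
      using rank_card_indpt[OF A W] rank by simp
    have W': "W \<subseteq> set (cols A)" "lin_indpt W"
      using W unfolding maximal_def by auto
    then have "basis W"
      using card cols dim_is_n by (intro dim_li_is_basis) (auto intro: finite_subset)
    then have "span W = carrier_vec n"
      unfolding basis_def by simp
    then show "span (set (cols A)) = carrier_vec n"
      using span_is_monotone[OF W'(1)] span_closed[OF cols] by auto
  next
    assume span: "span (set (cols A)) = carrier_vec n"
    have "V\<lparr>carrier := carrier_vec n\<rparr> = V"
      by (simp add: module_vec_def)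
    then show "rank A = n"
      unfolding rank_def span by (simp only: dim_is_n)
  qed
  also have "\<dots> \<longleftrightarrow> (\<forall>v. (\<forall>c<m. (\<Sum>i<n. v i * A $$ (i, c)) = 0) \<longrightarrow> (\<forall>i<n. v i = 0))"
  proof (intro iffI allI impI)
    fix v i
    assume span: "span (set (cols A)) = carrier_vec n"
      and v: "\<forall>c<m. (\<Sum>i<n. v i * A $$ (i, c)) = 0" and i: "i < n"
    have "unit_vec n i \<in> span (set (cols A))"
      by (simp add: span)
    then obtain x where x: "x \<in> carrier_vec m" "A *\<^sub>v x = unit_vec n i"
      by (auto simp: col_space)
    have eq: "unit_vec n i $ j = (\<Sum>c<m. A $$ (j, c) * x $ c)" if "j < n" for j
      using that A x(1) unfolding x(2)[symmetric]
      by (auto simp: scalar_prod_def lessThan_atLeast0 intro!: sum.cong)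
    have "v i = (\<Sum>j<n. v j * unit_vec n i $ j)"
      using i by (simp add: if_distrib[of "(*) _"] cong: if_cong)
    also have "\<dots> = (\<Sum>j<n. \<Sum>c<m. x $ c * (v j * A $$ (j, c)))"
      by (simp add: eq sum_distrib_left mult_ac del: index_unit_vec)
    also have "\<dots> = (\<Sum>c<m. \<Sum>j<n. x $ c * (v j * A $$ (j, c)))"
      by (rule sum.swap)
    also have "\<dots> = 0"
      using v by (simp flip: sum_distrib_left)
    finally show "v i = 0" .
  next
    assume null: "\<forall>v. (\<forall>c<m. (\<Sum>i<n. v i * A $$ (i, c)) = 0) \<longrightarrow> (\<forall>i<n. v i = 0)"
    have "y \<in> span (set (cols A))" if y: "y \<in> carrier_vec n" for y
    proof -
      have "\<not> (\<exists>v. (\<forall>c\<in>{..<m}. (\<Sum>j<n. v j * A $$ (j, c)) = 0) \<and> (\<Sum>j<n. v j * y $ j) = 1)"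
      proof clarify
        fix v
        assume "\<forall>c\<in>{..<m}. (\<Sum>j<n. v j * A $$ (j, c)) = 0" "(\<Sum>j<n. v j * y $ j) = 1"
        then show False using null by auto
      qed
      then obtain z where z: "\<forall>j\<in>{..<n}. y $ j = (\<Sum>c<m. z c * A $$ (j, c))"
        using fredholm_alternative[of "{..<m}" "{..<n}" "\<lambda>j. y $ j" "\<lambda>c j. A $$ (j, c)"] by auto
      have "A *\<^sub>v vec m z = y"
        using A y z
        by (intro eq_vecI) (auto simp: scalar_prod_def lessThan_atLeast0 mult_ac intro!: sum.cong)
      then show ?thesis
        using y by (auto simp: col_space)
    qed
    then show "span (set (cols A)) = carrier_vec n"
      using span_closed[OF cols] by auto
  qed
  finally show ?thesis .
qed

lemma pow_mat_mult_entry: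
  fixes A B :: "real mat"
  assumes "A \<in> carrier_mat n n" "B \<in> carrier_mat n n" "i < n" "s < n"
  shows "(A ^\<^sub>m k * B) $$ (i, s) =
    (mv n (\<lambda>i j. A $$ (i, j)) ^^ k) (\<lambda>i. B $$ (i, s)) i"
  using assms(2)
proof (induction k arbitrary: B)
  case 0
  then show ?case using assms by simp
next
  case (Suc k)
  have "A ^\<^sub>m Suc k * B = A ^\<^sub>m k * (A * B)"
    using assms(1) Suc.prems by (simp add: assoc_mult_mat[of _ n n _ n _ n])
  then have "(A ^\<^sub>m Suc k * B) $$ (i, s) =
      (mv n (\<lambda>i j. A $$ (i, j)) ^^ k) (\<lambda>i. (A * B) $$ (i, s)) i"
    using Suc.IH[of "A * B"] assms(1) Suc.prems by simp
  also have "\<dots> = (mv n (\<lambda>i j. A $$ (i, j)) ^^ k)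
      (mv n (\<lambda>i j. A $$ (i, j)) (\<lambda>i. B $$ (i, s))) i"
    using assms Suc.prems
    by (intro mv_pow_cong) (auto simp: mv_def scalar_prod_def lessThan_atLeast0 intro!: sum.cong)
  finally show ?case
    by (simp only: funpow_Suc_right comp_apply)
qed

lemma controllable_iff_annihilator:
  fixes A B :: "real mat"
  assumes "A \<in> carrier_mat n n" "B \<in> carrier_mat n n"
  shows "controllable n A B \<longleftrightarrow>
    (\<forall>v. (\<forall>k. \<forall>s<n. dot n v ((mv n (\<lambda>i j. A $$ (i, j)) ^^ k) (\<lambda>i. B $$ (i, s))) = 0) \<longrightarrow>
         (\<forall>i<n. v i = 0))"
proof -
  let ?x = "\<lambda>k s. (mv n (\<lambda>i j. A $$ (i, j)) ^^ k) (\<lambda>i. B $$ (i, s))"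
  have col: "(\<Sum>i<n. v i * controllability_mat n A B $$ (i, c)) = dot n v (?x (c div n) (c mod n))"
    if "c < n * n" for v c
  proof -
    have "c mod n < n" using that by (cases n) auto
    then show ?thesis
      using that assms
      by (auto simp: controllability_mat_def dot_def pow_mat_mult_entry[OF assms] intro!: sum.cong
          simp del: index_mult_mat)
  qed
  have "(\<forall>c<n * n. (\<Sum>i<n. v i * controllability_mat n A B $$ (i, c)) = 0) \<longleftrightarrow>
      (\<forall>k. \<forall>s<n. dot n v (?x k s) = 0)" for v
  proof (intro iffI allI impI)
    fix k s
    assume v: "\<forall>c<n * n. (\<Sum>i<n. v i * controllability_mat n A B $$ (i, c)) = 0" and s: "s < n"
    show "dot n v (?x k s) = 0"
    proof (rule orbit_vanishes_of_below_dim)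
      fix k assume k: "k < n"
      have "Suc k * n \<le> n * n"
        using k by (intro mult_le_mono1) simp
      then have "k * n + s < n * n"
        using s by simp
      then show "dot n v (?x k s) = 0"
        using v col[of "k * n + s" v] s by auto
    qed
  next
    fix c
    assume v: "\<forall>k. \<forall>s<n. dot n v (?x k s) = 0" and c: "c < n * n"
    then have "c mod n < n" by (cases n) auto
    then show "(\<Sum>i<n. v i * controllability_mat n A B $$ (i, c)) = 0"
      using v col[OF c] by simp
  qed
  moreover have "controllability_mat n A B \<in> carrier_mat n (n * n)"
    by (simp add: controllability_mat_def)
  ultimately show ?thesis
    by (simp add: controllable_def full_row_rank_iff)
qed

text \<open>If rows \<open>X\<close> of the block matrix \<open>[A B]\<close> had fewer than \<open>card X\<close> nonzero columns, they would be linearly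
dependent. The coefficients of a dependency form a vector \<open>v\<close> with \<open>v A = 0\<close> and \<open>v B = 0\<close>, which
annihilates every block \<open>A\<^sup>k B\<close> of the controllability matrix.\<close>

lemma controllable_imp_hall_condition:
  fixes A B :: "real mat"
  assumes A: "A \<in> carrier_mat n n" and B: "B \<in> carrier_mat n n"
    and ctrl: "controllable n A B" and X: "X \<subseteq> {..<n}"
  shows "card X \<le> card (\<Union>i\<in>X. Inl ` {j. j < n \<and> A $$ (i, j) \<noteq> 0} \<union>
    Inr ` {k. k < n \<and> B $$ (i, k) \<noteq> 0})" (is "_ \<le> card ?N")
proof (rule ccontr)
  assume less: "\<not> card X \<le> card ?N"
  have fin: "finite X"
    using X finite_subset by blast
  define e where "e i c = (case c of Inl j \<Rightarrow> A $$ (i, j) | Inr k \<Rightarrow> B $$ (i, k))" for i c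
  obtain x where x: "\<exists>i\<in>X. x i \<noteq> 0" "\<forall>c\<in>?N. (\<Sum>i\<in>X. x i * e i c) = 0"
    using underdetermined[of ?N X e] less fin by auto
  define v where "v i = (if i \<in> X then x i else 0)" for i
  have v: "dot n v z = (\<Sum>i\<in>X. x i * z i)" for z
    unfolding dot_def using X by (intro sum.mono_neutral_cong_right) (auto simp: v_def)
  have col_A: "dot n v (\<lambda>i. A $$ (i, j)) = 0" if "j < n" for j
  proof (cases "Inl j \<in> ?N")
    case True
    show ?thesis using bspec[OF x(2) True] by (simp add: v e_def)
  next
    case False
    then have "A $$ (i, j) = 0" if "i \<in> X" for i
      using that \<open>j < n\<close> by blast
    then show ?thesis by (simp add: v)
  qed
  have col_B: "dot n v (\<lambda>i. B $$ (i, k)) = 0" if "k < n" for k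
  proof (cases "Inr k \<in> ?N")
    case True
    show ?thesis using bspec[OF x(2) True] by (simp add: v e_def)
  next
    case False
    then have "B $$ (i, k) = 0" if "i \<in> X" for i
      using that \<open>k < n\<close> by blast
    then show ?thesis by (simp add: v)
  qed
  have "dot n v ((mv n (\<lambda>i j. A $$ (i, j)) ^^ k) (\<lambda>i. B $$ (i, s))) = 0" if "s < n" for k s
  proof (cases k)
    case 0
    then show ?thesis using col_B[OF that] by simp
  next
    case (Suc l)
    have "dot n v (mv n (\<lambda>i j. A $$ (i, j)) z) = 0" for z
      unfolding dot_mv using col_A by (simp add: dot_def)
    then show ?thesis using Suc by simp
  qed
  then have "\<forall>i<n. v i = 0"
    using ctrl unfolding controllable_iff_annihilator[OF A B] by blast
  then show False
    using x(1) X by (auto simp: v_def)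
qed

section \<open>Structural controllability of a strongly connected digraph\<close>

lemma mv_pow_cong_mat:
  assumes "\<And>i j. i < n \<Longrightarrow> j < n \<Longrightarrow> a i j = b i j"
  shows "i < n \<Longrightarrow> (mv n a ^^ k) x i = (mv n b ^^ k) x i"
proof (induction k arbitrary: i)
  case (Suc k)
  then show ?case using assms by (simp add: mv_def)
qed simp

lemma extend_inj_to_permutation:
  assumes "inj_on \<pi> ({..<n::nat} - S)" "\<pi> ` ({..<n} - S) \<subseteq> {..<n}" "S \<subseteq> {..<n}"
  obtains \<rho> where "\<rho> permutes {..<n}" "\<And>i. i \<in> {..<n} - S \<Longrightarrow> \<rho> i = \<pi> i"
proof -
  let ?D = "{..<n} - S" and ?I = "\<pi> ` ({..<n} - S)"
  have fin: "finite S"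
    using assms(3) finite_subset by blast
  have "card ({..<n} - ?I) = card S"
    using assms fin by (simp add: card_Diff_subset card_image card_mono)
      (metis card_lessThan card_mono diff_diff_cancel finite_lessThan)
  then obtain h where h: "bij_betw h S ({..<n} - ?I)"
    using finite_same_card_bij[of S "{..<n} - ?I"] fin by auto
  define \<rho> where "\<rho> i = (if i \<in> S then h i else if i < n then \<pi> i else i)" for i
  have "bij_betw \<rho> S ({..<n} - ?I)"
    using h by (rule bij_betw_cong[THEN iffD1, rotated]) (simp add: \<rho>_def)
  moreover have "bij_betw \<rho> ?D ?I"
    using inj_on_imp_bij_betw[OF assms(1)]
    by (rule bij_betw_cong[THEN iffD1, rotated]) (simp add: \<rho>_def)
  ultimately have "bij_betw \<rho> (S \<union> ?D) (({..<n} - ?I) \<union> ?I)"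
    by (rule bij_betw_combine) auto
  moreover have "S \<union> ?D = {..<n}" "({..<n} - ?I) \<union> ?I = {..<n}"
    using assms by auto
  ultimately have "bij_betw \<rho> {..<n} {..<n}"
    by metis
  then have "\<rho> permutes {..<n}"
    by (rule bij_imp_permutes) (use assms(3) in \<open>auto simp: \<rho>_def\<close>)
  then show ?thesis
    using that[of \<rho>] by (auto simp: \<rho>_def)
qed

lemma strongly_connected_exit:
  assumes "strongly_connected (with_proj G)" "U \<subset> pverts G" "U \<noteq> {}"
  shows "\<exists>p\<in>U. \<exists>q\<in>pverts G - U. (p, q) \<in> parcs G"
proof (rule ccontr)
  assume no_exit: "\<not> ?thesis"
  obtain u w where uw: "u \<in> U" "w \<in> pverts G" "w \<notin> U"
    using assms by blast
  then have "u \<rightarrow>\<^sup>*\<^bsub>with_proj G\<^esub> w"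
    using assms unfolding strongly_connected_def by auto
  then have "(u, w) \<in> rtrancl_on (pverts G) (parcs G)"
    by (simp add: reachable_def)
  then have "w \<in> U"
  proof (induction rule: rtrancl_on_induct)
    case base
    show ?case by (rule uw)
  next
    case (step y z)
    then show ?case using no_exit by blast
  qed
  then show False using uw by simp
qed

text \<open>The matching gives every unactuated node \<open>i\<close> its own predecessor \<open>\<pi> i\<close>. Completing \<open>\<pi>\<close> to a permutation
adds edges into actuated nodes only, and these can be erased again by feedback invariance. Strong
connectivity supplies the edges along which the controlled set grows, so some matrix supported on the
digraph is controllable, and a small perturbation has exactly the zeros of \<open>A\<close>.\<close>

lemma structurally_controllable_of_matching:
  assumes A: "A \<in> carrier_mat n n"
    and conn: "strongly_connected (with_proj (digraph_of n A))"
    and S: "S \<subseteq> {..<n}" "S \<noteq> {}"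
    and inj: "inj_on \<pi> ({..<n} - S)"
    and \<pi>: "\<And>i. i \<in> {..<n} - S \<Longrightarrow> \<pi> i < n \<and> A $$ (i, \<pi> i) \<noteq> 0"
  shows "structurally_controllable n A (actuator_mat n S)"
proof -
  obtain \<rho> where \<rho>: "\<rho> permutes {..<n}" "\<And>i. i \<in> {..<n} - S \<Longrightarrow> \<rho> i = \<pi> i"
    using extend_inj_to_permutation[OF inj _ S(1)] \<pi> by blast
  have exit: "\<exists>p\<in>U. \<exists>q\<in>{..<n} - U. q < n \<and> p < n \<and> A $$ (q, p) \<noteq> 0"
    if "S \<subseteq> U" "U \<subset> {..<n}" for U
    using strongly_connected_exit[OF conn, of U] that S(2)
    by (auto simp: digraph_of_def lessThan_atLeast0)
  obtain a where a: "\<And>i j. a i j \<noteq> 0 \<Longrightarrow> (i < n \<and> j < n \<and> A $$ (i, j) \<noteq> 0) \<or> i = inv_into UNIV \<rho> j"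
      "controls n a S {..<n}"
    by (rule controls_of_permutation[OF permutes_inv[OF \<rho>(1)] S(1) exit]) blast+
  define a' where "a' i j = (if i \<in> S then 0 else a i j)" for i j
  have a': "controls n a' S {..<n}"
    unfolding a'_def[abs_def] by (rule controls_drop_actuated_rows[OF a(2) S(1)])
  have "i < n \<longrightarrow> A $$ (i, j) \<noteq> 0" if "a' i j \<noteq> 0" for i j
  proof
    assume i: "i < n"
    have "i \<notin> S" "a i j \<noteq> 0"
      using that by (auto simp: a'_def split: if_splits)
    from a(1)[OF this(2)] show "A $$ (i, j) \<noteq> 0"
    proof
      assume "i = inv_into UNIV \<rho> j"
      then have "\<rho> i = j"
        using \<rho>(1) by (simp add: permutes_inverses)
      then show ?thesis
        using \<pi>[of i] \<rho>(2)[of i] i \<open>i \<notin> S\<close> by simp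
    qed simp
  qed
  then obtain b where b: "\<And>i j. i < n \<Longrightarrow> j < n \<Longrightarrow> b i j \<noteq> 0 \<longleftrightarrow> (i < n \<longrightarrow> A $$ (i, j) \<noteq> 0)"
      "controls n b S {..<n}"
    by (rule controls_full_pattern[OF a' S(1)]) blast+
  define A' where "A' = mat n n (\<lambda>(i, j). b i j)"
  have A': "A' \<in> carrier_mat n n"
    by (simp add: A'_def)
  have B: "actuator_mat n S \<in> carrier_mat n n"
    by (simp add: actuator_mat_def)
  have "controllable n A' (actuator_mat n S)"
    unfolding controllable_iff_annihilator[OF A' B]
  proof (rule allI, rule impI)
    fix v
    assume v: "\<forall>k. \<forall>s<n. dot n v ((mv n (\<lambda>i j. A' $$ (i, j)) ^^ k)
      (\<lambda>i. actuator_mat n S $$ (i, s))) = 0"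
    have "dot n v ((mv n b ^^ k) (unit s)) = 0" if s: "s \<in> S" for k s
    proof -
      have "dot n v ((mv n b ^^ k) (unit s)) =
          dot n v ((mv n (\<lambda>i j. A' $$ (i, j)) ^^ k) (unit s))"
        by (intro dot_cong mv_pow_cong_mat) (auto simp: A'_def)
      also have "\<dots> = dot n v ((mv n (\<lambda>i j. A' $$ (i, j)) ^^ k)
          (\<lambda>i. actuator_mat n S $$ (i, s)))"
        using s S(1) by (intro dot_cong mv_pow_cong) (auto simp: actuator_mat_def unit_def)
      finally show ?thesis
        using v s S(1) by auto
    qed
    then show "\<forall>i<n. v i = 0"
      using b(2) by (auto simp: controls_def)
  qed
  moreover have "same_zeros n A' A"
    using b(1) by (auto simp: same_zeros_def A'_def)
  ultimately show ?thesis
    using A' B unfolding structurally_controllable_def same_zeros_def by blast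
qed

section \<open>Flows and fractional matchings\<close>

text \<open>A flow of value \<open>n\<close> is determined by its values \<open>\<phi> i j\<close> and \<open>d i\<close> on the arcs that enter the nodes
\<open>Single i\<close>; conservation gives its values on all other arcs. The conditions are the flow conditions in
terms of these values: the sink arcs are saturated, and the capacities of the source arcs bound the
column sums of \<open>\<phi>\<close> and the total of \<open>d\<close>.\<close>

definition fractional_matching ::
    "nat \<Rightarrow> real mat \<Rightarrow> nat set \<Rightarrow> nat \<Rightarrow> (nat \<Rightarrow> nat \<Rightarrow> real) \<Rightarrow> (nat \<Rightarrow> real) \<Rightarrow> bool" where
  "fractional_matching n A S K \<phi> d \<longleftrightarrow>
     (\<forall>i<n. \<forall>j<n. 0 \<le> \<phi> i j \<and> (\<phi> i j \<noteq> 0 \<longrightarrow> A $$ (i, j) \<noteq> 0)) \<and>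
     (\<forall>i<n. 0 \<le> d i \<and> (d i \<noteq> 0 \<longrightarrow> i \<in> S)) \<and>
     (\<forall>i<n. (\<Sum>j<n. \<phi> i j) + d i = 1) \<and>
     (\<forall>j<n. (\<Sum>i<n. \<phi> i j) \<le> 1) \<and>
     (\<Sum>i<n. d i) \<le> real K"

context
  fixes n :: nat and A :: "real mat" and S :: "nat set"
  assumes S_n: "S \<subseteq> {..<n}"
begin

abbreviation "net \<equiv> with_proj (flow_net n A S)"

lemma pverts_net:
  "pverts (flow_net n A S) =
     Orig ` {0..<n} \<union> Double ` S \<union> Single ` {0..<n} \<union> {Source, Sink, Gate}"
  by (simp add: flow_net_def)

lemma arcs_at_nodes:
  "out_arcs net Source = insert (Source, Gate) ((\<lambda>j. (Source, Orig j)) ` {..<n})"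
  "in_arcs net Gate = {(Source, Gate)}"
  "out_arcs net Gate = (\<lambda>k. (Gate, Double k)) ` S"
  "j < n \<Longrightarrow> in_arcs net (Orig j) = {(Source, Orig j)}"
  "j < n \<Longrightarrow> out_arcs net (Orig j) = (\<lambda>i. (Orig j, Single i)) ` {i. i < n \<and> A $$ (i, j) \<noteq> 0}"
  "k \<in> S \<Longrightarrow> in_arcs net (Double k) = {(Gate, Double k)}"
  "k \<in> S \<Longrightarrow> out_arcs net (Double k) = {(Double k, Single k)}"
  "i < n \<Longrightarrow> in_arcs net (Single i) = (\<lambda>j. (Orig j, Single i)) ` {j. j < n \<and> A $$ (i, j) \<noteq> 0} \<union>
     (if i \<in> S then {(Double i, Single i)} else {})"
  "i < n \<Longrightarrow> out_arcs net (Single i) = {(Single i, Sink)}"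
  by (auto simp: in_arcs_def out_arcs_def flow_net_def digraph_of_def)

lemma sum_arcs_at_nodes:
  fixes g :: "hnode \<times> hnode \<Rightarrow> real"
  shows
  "sum g (out_arcs net Source) = g (Source, Gate) + (\<Sum>j<n. g (Source, Orig j))"
  "sum g (in_arcs net Gate) = g (Source, Gate)"
  "sum g (out_arcs net Gate) = (\<Sum>k\<in>S. g (Gate, Double k))"
  "j < n \<Longrightarrow> sum g (in_arcs net (Orig j)) = g (Source, Orig j)"
  "j < n \<Longrightarrow> sum g (out_arcs net (Orig j)) =
     (\<Sum>i<n. if A $$ (i, j) \<noteq> 0 then g (Orig j, Single i) else 0)"
  "k \<in> S \<Longrightarrow> sum g (in_arcs net (Double k)) = g (Gate, Double k)"
  "k \<in> S \<Longrightarrow> sum g (out_arcs net (Double k)) = g (Double k, Single k)"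
  "i < n \<Longrightarrow> sum g (in_arcs net (Single i)) =
     (\<Sum>j<n. if A $$ (i, j) \<noteq> 0 then g (Orig j, Single i) else 0) +
     (if i \<in> S then g (Double i, Single i) else 0)"
  "i < n \<Longrightarrow> sum g (out_arcs net (Single i)) = g (Single i, Sink)"
proof -
  have restrict: "(\<Sum>i<n. if P i then h i else 0) = sum h {i. i < n \<and> P i}" for P and h :: "nat \<Rightarrow> real"
    by (subst sum.inter_filter[symmetric]) (auto intro!: sum.cong)
  show
  "sum g (out_arcs net Source) = g (Source, Gate) + (\<Sum>j<n. g (Source, Orig j))"
    unfolding arcs_at_nodes by (subst sum.insert) (auto simp: sum.reindex inj_on_def)
  show "sum g (out_arcs net Gate) = (\<Sum>k\<in>S. g (Gate, Double k))"
    unfolding arcs_at_nodes by (subst sum.reindex) (auto simp: inj_on_def)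
  show "sum g (out_arcs net (Orig j)) =
     (\<Sum>i<n. if A $$ (i, j) \<noteq> 0 then g (Orig j, Single i) else 0)" if "j < n"
    unfolding arcs_at_nodes(5)[OF that] restrict by (subst sum.reindex) (auto simp: inj_on_def)
  show "sum g (in_arcs net (Single i)) =
     (\<Sum>j<n. if A $$ (i, j) \<noteq> 0 then g (Orig j, Single i) else 0) +
     (if i \<in> S then g (Double i, Single i) else 0)" if "i < n"
    unfolding arcs_at_nodes(8)[OF that] restrict
    by (subst sum.union_disjoint) (auto simp: sum.reindex inj_on_def)
qed (simp_all add: arcs_at_nodes)

lemma fractional_matching_of_flow:
  assumes flow: "is_flow net (net_capacity K) Source Sink g"
    and val: "flow_value net Source g = real n"
  shows "\<exists>\<phi> d. fractional_matching n A S K \<phi> d"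
proof -
  define \<phi> where "\<phi> i j = (if A $$ (i, j) \<noteq> 0 then g (Orig j, Single i) else 0)" for i j
  define d where "d i = (if i \<in> S then g (Double i, Single i) else 0)" for i
  have arc: "0 \<le> g e" "g e \<le> net_capacity K e" if "e \<in> parcs (flow_net n A S)" for e
    using flow that by (auto simp: is_flow_def)
  have cons: "sum g (in_arcs net w) = sum g (out_arcs net w)"
    if "w \<in> pverts (flow_net n A S)" "w \<noteq> Source" "w \<noteq> Sink" for w
    using flow that by (auto simp: is_flow_def)
  have col: "(\<Sum>i<n. \<phi> i j) = g (Source, Orig j)" if "j < n" for j
    using cons[of "Orig j"] that by (simp add: sum_arcs_at_nodes \<phi>_def pverts_net)
  have row: "(\<Sum>j<n. \<phi> i j) + d i = g (Single i, Sink)" if "i < n" for i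
    using cons[of "Single i"] that by (simp add: sum_arcs_at_nodes \<phi>_def d_def pverts_net)
  have "(\<Sum>i<n. d i) = (\<Sum>k\<in>S. g (Gate, Double k))"
  proof -
    have "g (Double k, Single k) = g (Gate, Double k)" if "k \<in> S" for k
      using cons[of "Double k"] that by (simp add: sum_arcs_at_nodes pverts_net)
    then show ?thesis
      using S_n by (intro sum.mono_neutral_cong_right) (auto simp: d_def)
  qed
  also have "\<dots> = g (Source, Gate)"
    using cons[of Gate] by (simp add: sum_arcs_at_nodes pverts_net)
  finally have gate: "(\<Sum>i<n. d i) = g (Source, Gate)" .
  have "(\<Sum>i<n. g (Single i, Sink)) = (\<Sum>i<n. (\<Sum>j<n. \<phi> i j) + d i)"
    using row by simp
  also have "\<dots> = (\<Sum>j<n. \<Sum>i<n. \<phi> i j) + (\<Sum>i<n. d i)"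
    by (subst sum.swap) (simp add: sum.distrib)
  also have "\<dots> = real n"
    using val by (simp add: flow_value_def sum_arcs_at_nodes col gate)
  \<comment> \<open>the \<open>n\<close> unit arcs into the sink carry \<open>n\<close> units, so each of them is saturated\<close>
  finally have "(\<Sum>i<n. 1 - g (Single i, Sink)) = 0"
    by (simp add: sum_subtractf)
  moreover have sink: "g (Single i, Sink) \<le> 1" if "i < n" for i
    using arc(2)[of "(Single i, Sink)"] that by (simp add: flow_net_def net_capacity_def)
  ultimately have full: "g (Single i, Sink) = 1" if "i < n" for i
    using sum_nonneg_eq_0_iff[of "{..<n}" "\<lambda>i. 1 - g (Single i, Sink)"] that by auto
  have "0 \<le> \<phi> i j" if "i < n" "j < n" for i j
    using arc(1)[of "(Orig j, Single i)"] that by (auto simp: \<phi>_def flow_net_def digraph_of_def)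
  moreover have "0 \<le> d i" for i
    using arc(1)[of "(Double i, Single i)"] by (auto simp: d_def flow_net_def)
  moreover have "g (Source, Orig j) \<le> 1" if "j < n" for j
    using arc(2)[of "(Source, Orig j)"] that by (simp add: flow_net_def net_capacity_def)
  moreover have "g (Source, Gate) \<le> real K"
    using arc(2)[of "(Source, Gate)"] by (simp add: flow_net_def net_capacity_def)
  ultimately have "fractional_matching n A S K \<phi> d"
    unfolding fractional_matching_def using row full col gate
    by (auto simp: \<phi>_def d_def)
  then show ?thesis by blast
qed

lemma flow_of_fractional_matching:
  assumes "fractional_matching n A S K \<phi> d"
  shows "\<exists>g. is_flow net (net_capacity K) Source Sink g \<and> flow_value net Source g = real n"
proof -
  have \<phi>: "0 \<le> \<phi> i j" "A $$ (i, j) = 0 \<Longrightarrow> \<phi> i j = 0" if "i < n" "j < n" for i j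
    using assms that by (auto simp: fractional_matching_def)
  have d: "0 \<le> d i" "i \<notin> S \<Longrightarrow> d i = 0" if "i < n" for i
    using assms that by (auto simp: fractional_matching_def)
  have row: "(\<Sum>j<n. \<phi> i j) + d i = 1" if "i < n" for i
    using assms that by (auto simp: fractional_matching_def)
  have col: "(\<Sum>i<n. \<phi> i j) \<le> 1" if "j < n" for j
    using assms that by (auto simp: fractional_matching_def)
  have gate: "(\<Sum>i<n. d i) \<le> real K"
    using assms by (auto simp: fractional_matching_def)
  have \<phi>_le: "\<phi> i j \<le> 1" if "i < n" "j < n" for i j
  proof -
    have "\<phi> i j \<le> (\<Sum>j<n. \<phi> i j)"
      using that \<phi> by (intro member_le_sum) auto
    then show ?thesis using row[OF that(1)] d(1)[OF that(1)] by simp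
  qed
  have d_le: "d i \<le> 1" if "i < n" for i
  proof -
    have "0 \<le> (\<Sum>j<n. \<phi> i j)"
      using that \<phi> by (intro sum_nonneg) auto
    then show ?thesis using row[OF that] by simp
  qed
  define g where "g e = (case e of
      (Orig j, Single i) \<Rightarrow> \<phi> i j
    | (Double k, _) \<Rightarrow> d k
    | (Source, Orig j) \<Rightarrow> \<Sum>i<n. \<phi> i j
    | (Source, Gate) \<Rightarrow> \<Sum>i<n. d i
    | (Gate, Double k) \<Rightarrow> d k
    | _ \<Rightarrow> 1)" for e
  have g_simps: "g (Orig j, Single i) = \<phi> i j" "g (Double k, Single l) = d k"
      "g (Source, Orig j) = (\<Sum>i<n. \<phi> i j)" "g (Source, Gate) = (\<Sum>i<n. d i)"
      "g (Gate, Double k) = d k" "g (Single i, Sink) = 1" for i j k l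
    by (simp_all add: g_def)
  have out_Orig: "(\<Sum>i<n. if A $$ (i, j) \<noteq> 0 then g (Orig j, Single i) else 0) = (\<Sum>i<n. \<phi> i j)"
    if "j < n" for j
    using that \<phi>(2) by (intro sum.cong) (auto simp: g_simps)
  have in_Single: "(\<Sum>j<n. if A $$ (i, j) \<noteq> 0 then g (Orig j, Single i) else 0) = (\<Sum>j<n. \<phi> i j)"
    if "i < n" for i
    using that \<phi>(2) by (intro sum.cong) (auto simp: g_simps)
  have d_S: "(\<Sum>k\<in>S. d k) = (\<Sum>i<n. d i)"
    using S_n d(2) by (intro sum.mono_neutral_left) auto
  have "is_flow net (net_capacity K) Source Sink g"
    unfolding is_flow_def
  proof (intro conjI ballI)
    fix e assume e: "e \<in> arcs net"
    have "0 \<le> g e \<and> g e \<le> net_capacity K e"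
      using e S_n \<phi> \<phi>_le d d_le col gate
      by (auto simp: flow_net_def digraph_of_def g_simps net_capacity_def subset_iff
          intro!: sum_nonneg)
    then show "0 \<le> g e" "g e \<le> net_capacity K e" by auto
  next
    fix w assume w: "w \<in> verts net - {Source, Sink}"
    then consider (Orig) j where "w = Orig j" "j < n" | (Double) k where "w = Double k" "k \<in> S"
      | (Single) i where "w = Single i" "i < n" | (Gate) "w = Gate"
      by (auto simp: flow_net_def)
    then show "sum g (in_arcs net w) = sum g (out_arcs net w)"
    proof cases
      case Orig
      then show ?thesis by (simp add: sum_arcs_at_nodes out_Orig g_simps(3))
    next
      case Double
      then show ?thesis by (simp add: sum_arcs_at_nodes g_simps)
    next
      case Single
      then show ?thesis
        using row[OF Single(2)] d(2)[OF Single(2)]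
        by (auto simp: sum_arcs_at_nodes in_Single g_simps(2,6))
    next
      case Gate
      then show ?thesis by (simp add: sum_arcs_at_nodes g_simps d_S)
    qed
  qed
  moreover have "flow_value net Source g = real n"
  proof -
    have "flow_value net Source g = (\<Sum>i<n. d i) + (\<Sum>j<n. \<Sum>i<n. \<phi> i j)"
      by (simp add: flow_value_def sum_arcs_at_nodes g_simps)
    also have "\<dots> = (\<Sum>i<n. (\<Sum>j<n. \<phi> i j) + d i)"
      by (subst sum.swap) (simp add: sum.distrib)
    also have "\<dots> = real n"
      using row by simp
    finally show ?thesis .
  qed
  ultimately show ?thesis by blast
qed

end

text \<open>The cardinality limit enters as \<open>K\<close> dummy columns adjacent to exactly the rows that may be actuated. The
rows \<open>X\<close> carry \<open>card X\<close> units in total, at most one through each adjacent column of \<open>A\<close> and at most \<open>K\<close>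
through the actuators. Thus Hall's theorem, applied to the columns of \<open>A\<close> and the dummies, replaces the
integrality of maximum flows.\<close>

lemma fractional_matching_hall_condition:
  assumes fm: "fractional_matching n A S K \<phi> d" and X: "X \<subseteq> {..<n}"
  shows "card X \<le> card (\<Union>i\<in>X. Inl ` {j. j < n \<and> A $$ (i, j) \<noteq> 0} \<union>
    (if i \<in> S then Inr ` {..<K} else {}))" (is "_ \<le> card ?\<Gamma>")
proof -
  have \<phi>: "0 \<le> \<phi> i j" "\<phi> i j \<noteq> 0 \<Longrightarrow> A $$ (i, j) \<noteq> 0" if "i < n" "j < n" for i j
    using fm that by (auto simp: fractional_matching_def)
  have d: "0 \<le> d i" "d i \<noteq> 0 \<Longrightarrow> i \<in> S" if "i < n" for i
    using fm that by (auto simp: fractional_matching_def)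
  have row: "(\<Sum>j<n. \<phi> i j) + d i = 1" if "i < n" for i
    using fm that by (auto simp: fractional_matching_def)
  have col: "(\<Sum>i<n. \<phi> i j) \<le> 1" if "j < n" for j
    using fm that by (auto simp: fractional_matching_def)
  have gate: "(\<Sum>i<n. d i) \<le> real K"
    using fm by (auto simp: fractional_matching_def)
  have Xn: "i < n" if "i \<in> X" for i
    using X that by auto
  define N where "N = {j. j < n \<and> (\<exists>i\<in>X. A $$ (i, j) \<noteq> 0)}"
  define D where "D = (if X \<inter> S = {} then {} else {..<K})"
  have "real (card X) = (\<Sum>i\<in>X. (\<Sum>j<n. \<phi> i j) + d i)"
    using row Xn by simp
  also have "\<dots> = (\<Sum>j<n. \<Sum>i\<in>X. \<phi> i j) + (\<Sum>i\<in>X. d i)"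
    by (subst sum.swap) (simp add: sum.distrib)
  also have "(\<Sum>j<n. \<Sum>i\<in>X. \<phi> i j) = (\<Sum>j\<in>N. \<Sum>i\<in>X. \<phi> i j)"
  proof (rule sum.mono_neutral_right)
    show "\<forall>j\<in>{..<n} - N. (\<Sum>i\<in>X. \<phi> i j) = 0"
      using \<phi>(2) Xn by (fastforce simp: N_def intro!: sum.neutral)
  qed (auto simp: N_def)
  also have "\<dots> \<le> (\<Sum>j\<in>N. 1)"
  proof (rule sum_mono)
    fix j assume "j \<in> N"
    then have j: "j < n" by (simp add: N_def)
    have "(\<Sum>i\<in>X. \<phi> i j) \<le> (\<Sum>i<n. \<phi> i j)"
      using X \<phi>(1) j by (intro sum_mono2) auto
    then show "(\<Sum>i\<in>X. \<phi> i j) \<le> 1" using col[OF j] by simp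
  qed
  also have "(\<Sum>i\<in>X. d i) \<le> real (card D)"
  proof (cases "X \<inter> S = {}")
    case True
    then have "(\<Sum>i\<in>X. d i) = 0"
      using d(2) Xn by (intro sum.neutral) blast
    then show ?thesis by simp
  next
    case False
    have "(\<Sum>i\<in>X. d i) \<le> (\<Sum>i<n. d i)"
      using X d(1) by (intro sum_mono2) auto
    then show ?thesis using gate False by (simp add: D_def)
  qed
  finally have "card X \<le> card N + card D"
    by simp
  also have "\<dots> = card (Inl ` N \<union> Inr ` D :: (nat + nat) set)"
    by (subst card_Un_disjoint) (auto simp: card_image N_def D_def)
  also have "(Inl ` N \<union> Inr ` D :: (nat + nat) set) = ?\<Gamma>"
    by (auto simp: N_def D_def split: if_splits)
  finally show ?thesis .
qed

section \<open>The flow criterion\<close>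

theorem proposition8:
  fixes n K :: nat and A :: "real mat" and R :: "nat set"
  assumes "A \<in> carrier_mat n n"
    and "strongly_connected (with_proj (digraph_of n A))"
    and "K \<ge> 1"
    and "R \<subseteq> {0..<n}"
    and "K \<le> card ({0..<n} - R)"
  shows "R \<in> feasible_exclusions n A K \<longleftrightarrow>
    (\<exists>g. is_flow (with_proj (flow_net n A ({0..<n} - R))) (net_capacity K) Source Sink g \<and>
         flow_value (with_proj (flow_net n A ({0..<n} - R))) Source g = real n)"
    (is "?L \<longleftrightarrow> ?R")
proof
  assume ?L
  then obtain Q where Q: "R \<subseteq> Q" "Q \<subseteq> {0..<n}" "{0..<n} - Q \<in> actuator_sets n A K"
    by (auto simp: feasible_exclusions_def complement_sets_def)
  define T where "T = {0..<n} - Q"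
  obtain A' B' where A': "A' \<in> carrier_mat n n" "B' \<in> carrier_mat n n"
      "same_zeros n A' A" "same_zeros n B' (actuator_mat n T)" "controllable n A' B'"
    and T: "card T = K"
    using Q(3) by (auto simp: T_def actuator_sets_def structurally_controllable_def)
  define \<Gamma> :: "nat \<Rightarrow> (nat + nat) set" where "\<Gamma> i = Inl ` {j. j < n \<and> A' $$ (i, j) \<noteq> 0} \<union> Inr ` {k. k < n \<and> B' $$ (i, k) \<noteq> 0}" for i
  have "\<exists>f. inj_on f {..<n} \<and> (\<forall>i\<in>{..<n}. f i \<in> \<Gamma> i)"
    unfolding \<Gamma>_def
    by (rule hall) (use controllable_imp_hall_condition[OF A'(1,2,5)] in auto)
  then obtain f where f: "inj_on f {..<n}" "\<And>i. i < n \<Longrightarrow> f i \<in> \<Gamma> i"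
    by auto
  have f_cases: "(\<exists>j<n. f i = Inl j \<and> A $$ (i, j) \<noteq> 0) \<or> f i = Inr i \<and> i \<in> T" if "i < n" for i
    using f(2)[OF that] that A'(3,4)
    by (auto simp: \<Gamma>_def same_zeros_def actuator_mat_def split: if_splits)
  define \<phi> :: "nat \<Rightarrow> nat \<Rightarrow> real" where "\<phi> i j = (if f i = Inl j then 1 else 0)" for i j
  define d :: "nat \<Rightarrow> real" where "d i = (if f i = Inr i then 1 else 0)" for i
  have "fractional_matching n A ({0..<n} - R) K \<phi> d"
    unfolding fractional_matching_def
  proof (intro conjI allI impI)
    show "0 \<le> \<phi> i j" "0 \<le> d i" for i j
      by (simp_all add: \<phi>_def d_def)
    show "A $$ (i, j) \<noteq> 0" if "i < n" "\<phi> i j \<noteq> 0" for i j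
      using f_cases[OF that(1)] that(2) by (auto simp: \<phi>_def split: if_splits)
    show "i \<in> {0..<n} - R" if "i < n" "d i \<noteq> 0" for i
      using f_cases[OF that(1)] that(2) Q(1) by (auto simp: d_def T_def split: if_splits)
    show "(\<Sum>j<n. \<phi> i j) + d i = 1" if "i < n" for i
      using f_cases[OF that] by (auto simp: \<phi>_def d_def)
    show "(\<Sum>i<n. \<phi> i j) \<le> 1" for j
    proof (cases "\<exists>i<n. f i = Inl j")
      case True
      then obtain i where i: "i < n" "f i = Inl j" by blast
      have "(\<Sum>k<n. \<phi> k j) = (\<Sum>k<n. if k = i then 1 else 0)"
        using i f(1) by (intro sum.cong) (auto simp: \<phi>_def inj_on_def)
      then show ?thesis using i by simp
    next
      case False
      then have "(\<Sum>k<n. \<phi> k j) = 0"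
        by (intro sum.neutral) (auto simp: \<phi>_def)
      then show ?thesis by simp
    qed
    have "(\<Sum>i<n. d i) \<le> (\<Sum>i<n. if i \<in> T then 1 else 0)"
      using f_cases by (intro sum_mono) (fastforce simp: d_def)
    also have "\<dots> = real (card ({..<n} \<inter> T))"
      by (simp add: sum.If_cases)
    also have "{..<n} \<inter> T = T"
      by (auto simp: T_def)
    finally show "(\<Sum>i<n. d i) \<le> real K"
      using T by simp
  qed
  then show ?R
    by (intro flow_of_fractional_matching) auto
next
  assume ?R
  then obtain g where
    "is_flow (with_proj (flow_net n A ({0..<n} - R))) (net_capacity K) Source Sink g"
    "flow_value (with_proj (flow_net n A ({0..<n} - R))) Source g = real n"
    by blast
  moreover have "{0..<n} - R \<subseteq> {..<n}"
    by auto
  ultimately obtain \<phi> d where fm: "fractional_matching n A ({0..<n} - R) K \<phi> d"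
    using fractional_matching_of_flow by blast
  define \<Gamma> :: "nat \<Rightarrow> (nat + nat) set" where
    "\<Gamma> i = Inl ` {j. j < n \<and> A $$ (i, j) \<noteq> 0} \<union>
      (if i \<in> {0..<n} - R then Inr ` {..<K} else {})" for i
  have "\<exists>f. inj_on f {..<n} \<and> (\<forall>i\<in>{..<n}. f i \<in> \<Gamma> i)"
    unfolding \<Gamma>_def
    by (rule hall) (use fractional_matching_hall_condition[OF fm] in auto)
  then obtain f where f: "inj_on f {..<n}" "\<And>i. i < n \<Longrightarrow> f i \<in> \<Gamma> i"
    by auto
  \<comment> \<open>the rows matched to dummy columns are the nodes that have to be actuated\<close>
  define T where "T = {i. i < n \<and> f i \<in> range Inr}"
  have "f ` T \<subseteq> Inr ` {..<K}"
    using f(2) by (fastforce simp: T_def \<Gamma>_def split: if_splits)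
  then have "card (f ` T) \<le> K"
    using card_mono[of "Inr ` {..<K}" "f ` T"] by (simp add: card_image)
  moreover have "inj_on f T"
    using f(1) by (rule inj_on_subset) (auto simp: T_def)
  ultimately have "card T \<le> K"
    by (simp add: card_image)
  moreover have "T \<subseteq> {0..<n} - R"
    using f(2) by (fastforce simp: T_def \<Gamma>_def split: if_splits)
  \<comment> \<open>rows outside a larger set \<open>W\<close> are still matched to columns of \<open>A\<close>, so \<open>T\<close> may be filled up to \<open>K\<close> nodes\<close>
  ultimately obtain W where W: "T \<subseteq> W" "W \<subseteq> {0..<n} - R" "card W = K"
    using exists_subset_between[of T K "{0..<n} - R"] assms(5) by auto
  define \<pi> where "\<pi> i = projl (f i)" for i
  have \<pi>: "f i = Inl (\<pi> i)" "\<pi> i < n" "A $$ (i, \<pi> i) \<noteq> 0" if "i \<in> {..<n} - W" for i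
    using f(2)[of i] that W(1) by (auto simp: T_def \<Gamma>_def \<pi>_def split: if_splits)
  have "inj_on \<pi> ({..<n} - W)"
    using f(1) \<pi>(1) unfolding inj_on_def by (metis DiffD1)
  then have "structurally_controllable n A (actuator_mat n W)"
    using assms(1-3) W \<pi> by (intro structurally_controllable_of_matching[of A n W \<pi>]) auto
  moreover have "{0..<n} - ({0..<n} - W) = W"
    using W(2) by auto
  ultimately have "{0..<n} - W \<in> complement_sets n A K"
    using W by (auto simp: complement_sets_def actuator_sets_def)
  moreover have "R \<subseteq> {0..<n} - W"
    using assms(4) W(2) by auto
  ultimately show ?L
    by (auto simp: feasible_exclusions_def)
qed

end
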